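(* For any $r\in(0,1)$ there is a sequence $\{v_m\}$ such that the rates $r_m$ of the extended BCH codes $\mathrm{eBCH}(v_m,m)$ satisfy $r_m\to r$ and the sequence $\{\mathrm{eBCH}(v_m,m)\}_m$ is capacity achieving on the BEC under block-MAP decoding.
   Context: Let $\alpha$ be a primitive element of $\mathbb{F}_{2^m}$. For $1\le v\le 2^m-1$, let $f(m,v)$ be the lowest-degree polynomial over $\mathbb{F}_2$ having $\alpha,\alpha^2,\dots,\alpha^v$ as roots; $\mathrm{BCH}(v,m)$ is the binary cyclic code of length $2^m-1$ with generator polynomial $f(m,v)$. $\mathrm{eBCH}(v,m)$ is the length-$2^m$ code obtained by appending to each codeword of $\mathrm{BCH}(v,m)$ an overall parity bit making the total weight even. A uniform codeword $\underline{X}$ is sent over $\mathrm{BEC}(p)$ (each bit independently erased with probability $p$) giving $\underline{Y}$; $P_B(p)$ is the probability that $\underline{X}$ is not uniquely determined by $\underline{Y}$. A sequence with rates $r_n\to r\in(0,1)$ is capacity achieving under block-MAP decoding if $P_B^{(n)}(p)\to0$ for all $p\in[0,1-r)$. *)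

theory Defs
  imports Complex_Main "HOL-Library.Z2" "HOL-Computational_Algebra.Polynomial" "HOL-Algebra.Ring"
begin

text \<open>Binary words are represented as functions nat => bit (only positions below the
length matter). Binary polynomials are bit poly. The field F_{2^m} is a HOL-Algebra field.\<close>

definition bit_in :: "('a, 'b) ring_scheme \<Rightarrow> bit \<Rightarrow> 'a" where
  "bit_in F b = (if b = 1 then \<one>\<^bsub>F\<^esub> else \<zero>\<^bsub>F\<^esub>)"

definition eval_in :: "('a, 'b) ring_scheme \<Rightarrow> bit poly \<Rightarrow> 'a \<Rightarrow> 'a" where
  "eval_in F p x = finsum F (\<lambda>j. bit_in F (coeff p j) \<otimes>\<^bsub>F\<^esub> x [^]\<^bsub>F\<^esub> j) {..degree p}"

definition has_bch_roots :: "('a, 'b) ring_scheme \<Rightarrow> 'a \<Rightarrow> nat \<Rightarrow> bit poly \<Rightarrow> bool" where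
  "has_bch_roots F \<alpha> v p \<longleftrightarrow> (\<forall>i\<in>{1..v}. eval_in F p (\<alpha> [^]\<^bsub>F\<^esub> i) = \<zero>\<^bsub>F\<^esub>)"

definition bch_gen :: "('a, 'b) ring_scheme \<Rightarrow> 'a \<Rightarrow> nat \<Rightarrow> bit poly" where
  "bch_gen F \<alpha> v = (SOME f. f \<noteq> 0 \<and> has_bch_roots F \<alpha> v f \<and>
      (\<forall>g. g \<noteq> 0 \<and> has_bch_roots F \<alpha> v g \<longrightarrow> degree f \<le> degree g))"

definition BCH :: "('a, 'b) ring_scheme \<Rightarrow> 'a \<Rightarrow> nat \<Rightarrow> nat \<Rightarrow> bit poly set" where
  "BCH F \<alpha> m v = {c. degree c < 2^m - 1 \<and> bch_gen F \<alpha> v dvd c}"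

definition eBCH :: "('a, 'b) ring_scheme \<Rightarrow> 'a \<Rightarrow> nat \<Rightarrow> nat \<Rightarrow> (nat \<Rightarrow> bit) set" where
  "eBCH F \<alpha> m v = (\<lambda>c i. if i < 2^m - 1 then coeff c i
                          else if i = 2^m - 1 then (\<Sum>j<2^m - 1. coeff c j) else 0) ` BCH F \<alpha> m v"

definition code_rate :: "(nat \<Rightarrow> bit) set \<Rightarrow> nat \<Rightarrow> real" where
  "code_rate C N = log 2 (real (card C)) / real N"

text \<open>Block-MAP error probability on BEC(p): uniform codeword x, erased set E;
failure iff another codeword agrees with x on all non-erased positions.\<close>
definition block_error_prob :: "(nat \<Rightarrow> bit) set \<Rightarrow> nat \<Rightarrow> real \<Rightarrow> real" where
  "block_error_prob C N p = (1 / real (card C)) *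
     (\<Sum>x\<in>C. \<Sum>E\<in>Pow {..<N}. p ^ card E * (1 - p) ^ (N - card E) *
        (if \<exists>x'\<in>C. x' \<noteq> x \<and> (\<forall>i\<in>{..<N} - E. x' i = x i) then 1 else 0))"

end

theory Submission
  imports Defs "HOL-Real_Asymp.Real_Asymp"
begin

text \<open>
  Identify a binary word with its support. With the field elements as positions, an extended BCH
  code consists of the sets whose power sums of orders \<open>0, \<dots>, v\<close> vanish, so it is invariant under
  the doubly transitive group of affine maps. Hence the EXIT function \<open>h\<close>, the probability that a
  position is not determined by the unerased other ones, is the same at every position, and all its
  influences agree.

  A sharp threshold follows from the method of Falik and Samorodnitsky: applying the log-Sobolev
  inequality of the biased cube to each martingale difference of the failure indicator gives
  \<open>h' \<ge> ln (N - 1) / 4 * h (1 - h)\<close> for length \<open>N = 2\<^sup>m\<close>. Since \<open>h\<close> is increasing and integrates to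
  the rate, which is at most \<open>r\<close>, it is bounded away from \<open>1\<close> below \<open>1 - r\<close>, and therefore
  decays there like a negative power of \<open>N\<close>.

  If block decoding fails, at least \<open>d\<close> positions are undetermined, \<open>d\<close> being the minimum
  distance, so the block error probability is at most \<open>N h / d\<close>. The BCH bound and the dimension
  count give \<open>d \<ge> v + 1 \<ge> (1 - r) N / m\<close>, and the factor \<open>m\<close> is absorbed by the decay of \<open>h\<close>.
\<close>

subsection \<open>The biased cube\<close>

text \<open>\<open>E\<close> is the random set of erased positions, weighted as in
  \<open>block_error_prob\<close>. The value is a polynomial in \<open>p\<close>; no range is
  imposed on \<open>p\<close>, so it can be differentiated at the end points too.\<close>

definition cube_exp :: "real \<Rightarrow> nat \<Rightarrow> (nat set \<Rightarrow> real) \<Rightarrow> real" where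
  "cube_exp p n f = (\<Sum>E\<in>Pow {..<n}. p ^ card E * (1 - p) ^ (n - card E) * f E)"

text \<open>Conditional expectation given all coordinates other than \<open>i\<close>.\<close>

definition coord_avg :: "real \<Rightarrow> nat \<Rightarrow> (nat set \<Rightarrow> real) \<Rightarrow> nat set \<Rightarrow> real" where
  "coord_avg p i f E = (1 - p) * f (E - {i}) + p * f (insert i E)"

definition coord_diff :: "nat \<Rightarrow> (nat set \<Rightarrow> real) \<Rightarrow> nat set \<Rightarrow> real" where
  "coord_diff i f E = f (insert i E) - f (E - {i})"

lemma Diff_singleton_lessThan: "E \<subseteq> {..<n} \<Longrightarrow> E - {n} = E" for E :: "nat set"
  by auto

lemma cube_exp_0 [simp]: "cube_exp p 0 f = f {}"
  by (simp add: cube_exp_def)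

lemma cube_exp_cong:
  "(\<And>E. E \<subseteq> {..<n} \<Longrightarrow> f E = g E) \<Longrightarrow> cube_exp p n f = cube_exp p n g"
  unfolding cube_exp_def by (intro sum.cong) auto

text \<open>Subsets are split by whether they contain \<open>n\<close>; this recursion drives the
  inductions on the dimension.\<close>

lemma cube_exp_Suc:
  "cube_exp p (Suc n) f = (1 - p) * cube_exp p n f + p * cube_exp p n (\<lambda>E. f (insert n E))"
proof -
  let ?w = "\<lambda>n E. p ^ card E * (1 - p) ^ (n - card E)"
  have inj: "inj_on (insert n) (Pow {..<n})"
    by (auto simp: inj_on_def)
  have card: "card E \<le> n" if "E \<subseteq> {..<n}" for E :: "nat set"
    using card_mono[OF _ that] by simp
  have "cube_exp p (Suc n) f = (\<Sum>E\<in>Pow {..<n} \<union> insert n ` Pow {..<n}. ?w (Suc n) E * f E)"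
    by (simp add: cube_exp_def lessThan_Suc Pow_insert)
  also have "\<dots> = (\<Sum>E\<in>Pow {..<n}. ?w (Suc n) E * f E)
      + (\<Sum>E\<in>Pow {..<n}. ?w (Suc n) (insert n E) * f (insert n E))"
    by (subst sum.union_disjoint) (auto simp: sum.reindex[OF inj])
  also have "(\<Sum>E\<in>Pow {..<n}. ?w (Suc n) E * f E) = (1 - p) * cube_exp p n f"
    unfolding cube_exp_def sum_distrib_left
    by (intro sum.cong refl) (auto simp: Suc_diff_le card)
  also have "(\<Sum>E\<in>Pow {..<n}. ?w (Suc n) (insert n E) * f (insert n E))
      = p * cube_exp p n (\<lambda>E. f (insert n E))"
    unfolding cube_exp_def sum_distrib_left
  proof (intro sum.cong refl)
    fix E :: "nat set" assume "E \<in> Pow {..<n}"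
    then have "card (insert n E) = Suc (card E)"
      using finite_subset by (subst card_insert_disjoint) auto
    then show "?w (Suc n) (insert n E) * f (insert n E) = p * (?w n E * f (insert n E))"
      by simp
  qed
  finally show ?thesis .
qed

lemma cube_exp_add: "cube_exp p n (\<lambda>E. f E + g E) = cube_exp p n f + cube_exp p n g"
  by (simp add: cube_exp_def sum.distrib algebra_simps)

lemma cube_exp_diff: "cube_exp p n (\<lambda>E. f E - g E) = cube_exp p n f - cube_exp p n g"
  by (simp add: cube_exp_def sum_subtractf algebra_simps)

lemma cube_exp_cmult: "cube_exp p n (\<lambda>E. c * f E) = c * cube_exp p n f"
  by (simp add: cube_exp_def sum_distrib_left algebra_simps)

lemma cube_exp_const [simp]: "cube_exp p n (\<lambda>E. c) = c"
  by (induction n) (auto simp: cube_exp_Suc algebra_simps)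

lemma cube_exp_sum: "cube_exp p n (\<lambda>E. \<Sum>i\<in>I. f i E) = (\<Sum>i\<in>I. cube_exp p n (f i))"
  unfolding cube_exp_def sum_distrib_left by (rule sum.swap)

lemma cube_exp_mono:
  assumes "0 \<le> p" "p \<le> 1" "\<And>E. E \<subseteq> {..<n} \<Longrightarrow> f E \<le> g E"
  shows "cube_exp p n f \<le> cube_exp p n g"
  unfolding cube_exp_def using assms by (intro sum_mono mult_left_mono) auto

lemma cube_exp_nonneg:
  assumes "0 \<le> p" "p \<le> 1" "\<And>E. E \<subseteq> {..<n} \<Longrightarrow> 0 \<le> f E"
  shows "0 \<le> cube_exp p n f"
  using cube_exp_mono[of p n "\<lambda>_. 0" f] assms by simp

lemma cube_exp_image:
  assumes "bij_betw \<sigma> {..<n} {..<n}"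
  shows "cube_exp p n (\<lambda>E. f (\<sigma> ` E)) = cube_exp p n f"
proof -
  have "inj_on \<sigma> E" if "E \<subseteq> {..<n}" for E
    using assms that by (meson bij_betw_imp_inj_on inj_on_subset)
  then have "card (\<sigma> ` E) = card E" if "E \<subseteq> {..<n}" for E
    using that by (simp add: card_image)
  then have "cube_exp p n (\<lambda>E. f (\<sigma> ` E)) =
      (\<Sum>E\<in>Pow {..<n}. p ^ card (\<sigma> ` E) * (1 - p) ^ (n - card (\<sigma> ` E)) * f (\<sigma> ` E))"
    unfolding cube_exp_def by (intro sum.cong) auto
  also have "\<dots> = cube_exp p n f"
    unfolding cube_exp_def by (rule sum.reindex_bij_betw[OF bij_betw_Pow[OF assms]])
  finally show ?thesis .
qed

lemma cube_exp_at_1: "cube_exp 1 n f = f {..<n}"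
  by (induction n arbitrary: f) (auto simp: cube_exp_Suc lessThan_Suc)

text \<open>Tower property of conditional expectation.\<close>

lemma cube_exp_coord_avg:
  "i < n \<Longrightarrow> cube_exp p n (coord_avg p i f) = cube_exp p n f"
proof (induction n arbitrary: f)
  case (Suc n)
  show ?case
  proof (cases "i = n")
    case True
    have 1: "cube_exp p n (coord_avg p n f) = (1 - p) * cube_exp p n f + p * cube_exp p n (\<lambda>E. f (insert n E))"
      unfolding cube_exp_cmult[symmetric] cube_exp_add[symmetric]
      by (intro cube_exp_cong) (auto simp: coord_avg_def Diff_singleton_lessThan)
    have 2: "cube_exp p n (\<lambda>E. coord_avg p n f (insert n E)) = cube_exp p n (coord_avg p n f)"
      by (intro cube_exp_cong) (auto simp: coord_avg_def)
    show ?thesis unfolding True cube_exp_Suc 2 unfolding 1 by (simp add: algebra_simps)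
  next
    case False
    then have "i < n" using Suc.prems by simp
    have "(\<lambda>E. coord_avg p i f (insert n E)) = coord_avg p i (\<lambda>E. f (insert n E))"
      using False by (auto simp: coord_avg_def fun_eq_iff insert_commute insert_Diff_if)
    then show ?thesis using Suc.IH \<open>i < n\<close> by (simp add: cube_exp_Suc)
  qed
qed simp

lemma coord_diff_avg_commute:
  assumes "i \<noteq> j"
  shows "coord_diff i (coord_avg p j f) = coord_avg p j (coord_diff i f)"
proof -
  have "E - {i} - {j} = E - {j} - {i}" "insert j (E - {i}) = insert j E - {i}"
    "insert i (E - {j}) = insert i E - {j}" "insert i (insert j E) = insert j (insert i E)" for E
    using assms by auto
  then show ?thesis by (auto simp: coord_avg_def coord_diff_def fun_eq_iff algebra_simps)
qed

lemma coord_diff_avg_same: "coord_diff i (coord_avg p i f) = (\<lambda>E. 0)"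
  by (auto simp: coord_avg_def coord_diff_def fun_eq_iff)

lemma coord_diff_diff: "coord_diff i (\<lambda>E. f E - g E) = (\<lambda>E. coord_diff i f E - coord_diff i g E)"
  by (auto simp: coord_diff_def)

text \<open>Pythagoras: averaging is an orthogonal projection. The residual averages to zero in
  direction \<open>i\<close>, and so does its product with the average, which does not depend on
  that coordinate.\<close>

lemma cube_exp_square_coord_avg:
  assumes "i < n"
  shows "cube_exp p n (\<lambda>E. (f E)\<^sup>2) =
    cube_exp p n (\<lambda>E. (f E - coord_avg p i f E)\<^sup>2) + cube_exp p n (\<lambda>E. (coord_avg p i f E)\<^sup>2)"
proof -
  let ?g = "coord_avg p i f"
  have "coord_avg p i (\<lambda>E. ?g E * (f E - ?g E)) = (\<lambda>E. 0)"
    by (auto simp: coord_avg_def fun_eq_iff algebra_simps)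
  then have 0: "cube_exp p n (\<lambda>E. ?g E * (f E - ?g E)) = 0"
    using cube_exp_coord_avg[OF assms, of p "\<lambda>E. ?g E * (f E - ?g E)"] by simp
  have "cube_exp p n (\<lambda>E. (f E)\<^sup>2) =
    cube_exp p n (\<lambda>E. (f E - ?g E)\<^sup>2 + (?g E)\<^sup>2 + 2 * (?g E * (f E - ?g E)))"
    by (intro cube_exp_cong) (simp add: power2_eq_square algebra_simps)
  then show ?thesis by (simp add: cube_exp_add cube_exp_cmult 0)
qed

lemma cube_exp_abs_coord_avg_le:
  assumes "i < n" "0 \<le> p" "p \<le> 1"
  shows "cube_exp p n (\<lambda>E. \<bar>coord_avg p i f E\<bar>) \<le> cube_exp p n (\<lambda>E. \<bar>f E\<bar>)"
proof -
  have "cube_exp p n (\<lambda>E. \<bar>coord_avg p i f E\<bar>) \<le> cube_exp p n (coord_avg p i (\<lambda>E. \<bar>f E\<bar>))"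
    using assms(2,3) unfolding coord_avg_def
    by (intro cube_exp_mono) (auto intro!: order_trans[OF abs_triangle_ineq] simp: abs_mult)
  then show ?thesis using cube_exp_coord_avg[OF assms(1)] by simp
qed

text \<open>Pointwise, the residual is the discrete derivative times \<open>1 - p\<close> or
  \<open>- p\<close>, depending on whether \<open>i\<close> lies in \<open>E\<close>.\<close>

lemma cube_exp_abs_minus_coord_avg_le:
  assumes "i < n" "0 \<le> p" "p \<le> 1"
  shows "cube_exp p n (\<lambda>E. \<bar>f E - coord_avg p i f E\<bar>) \<le> cube_exp p n (\<lambda>E. \<bar>coord_diff i f E\<bar>)"
proof (rule cube_exp_mono)
  fix E :: "nat set"
  show "\<bar>f E - coord_avg p i f E\<bar> \<le> \<bar>coord_diff i f E\<bar>"
  proof (cases "i \<in> E")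
    case True
    then have "f E - coord_avg p i f E = (1 - p) * coord_diff i f E"
      by (simp add: coord_avg_def coord_diff_def insert_absorb algebra_simps)
    then show ?thesis using assms by (simp add: abs_mult mult_left_le_one_le)
  next
    case False
    then have "f E - coord_avg p i f E = - p * coord_diff i f E"
      by (simp add: coord_avg_def coord_diff_def algebra_simps)
    then show ?thesis using assms by (simp add: abs_mult mult_left_le_one_le)
  qed
qed (use assms in auto)

text \<open>The Margulis-Russo formula: the product rule is applied to the recursion
  \<open>cube_exp_Suc\<close>, and the difference of the two halves is the term of the new
  coordinate.\<close>

lemma cube_exp_has_real_derivative:
  "((\<lambda>p. cube_exp p n f) has_real_derivative (\<Sum>j<n. cube_exp p n (coord_diff j f))) (at p)"
proof (induction n arbitrary: f)
  case (Suc n)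
  let ?f1 = "\<lambda>E. f (insert n E)"
  have ins: "(\<lambda>E. coord_diff j f (insert n E)) = coord_diff j ?f1" if "j < n" for j
    using that by (auto simp: coord_diff_def fun_eq_iff insert_commute insert_Diff_if)
  have last: "cube_exp p (Suc n) (coord_diff n f) = cube_exp p n ?f1 - cube_exp p n f"
  proof -
    have "cube_exp p n (coord_diff n f) = cube_exp p n ?f1 - cube_exp p n f"
      unfolding cube_exp_diff[symmetric]
      by (intro cube_exp_cong) (auto simp: coord_diff_def Diff_singleton_lessThan)
    moreover have "cube_exp p n (\<lambda>E. coord_diff n f (insert n E)) = cube_exp p n (coord_diff n f)"
      by (intro cube_exp_cong) (auto simp: coord_diff_def)
    ultimately show ?thesis by (simp add: cube_exp_Suc algebra_simps)
  qed
  have "((\<lambda>p. (1 - p) * cube_exp p n f + p * cube_exp p n ?f1) has_real_derivative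
      (1 - p) * (\<Sum>j<n. cube_exp p n (coord_diff j f)) - cube_exp p n f +
      (p * (\<Sum>j<n. cube_exp p n (coord_diff j ?f1)) + cube_exp p n ?f1)) (at p)"
    by (rule derivative_eq_intros Suc.IH refl | simp)+
  moreover have "(\<Sum>j<Suc n. cube_exp p (Suc n) (coord_diff j f)) =
      (1 - p) * (\<Sum>j<n. cube_exp p n (coord_diff j f)) - cube_exp p n f +
      (p * (\<Sum>j<n. cube_exp p n (coord_diff j ?f1)) + cube_exp p n ?f1)"
    unfolding sum.lessThan_Suc last
    by (simp add: cube_exp_Suc ins sum.distrib sum_distrib_left)
  ultimately show ?case by (simp add: cube_exp_Suc[abs_def])
qed simp

subsection \<open>A log-Sobolev inequality and influences\<close>

text \<open>The bound \<open>ln y \<le> y - 1\<close> at \<open>y = x / s\<close> estimates the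
  entropy of the square by its variance divided by its mean \<open>s\<close>. The constant in front
  of \<open>(a - b)\<^sup>2\<close> does not depend on \<open>p\<close>.\<close>

lemma two_point_log_sobolev:
  fixes a b p :: real
  assumes "0 \<le> p" "p \<le> 1"
  defines "s \<equiv> (1 - p) * a\<^sup>2 + p * b\<^sup>2"
  shows "(1 - p) * (a\<^sup>2 * ln (a\<^sup>2)) + p * (b\<^sup>2 * ln (b\<^sup>2)) \<le> (a - b)\<^sup>2 + s * ln s"
proof (cases "s = 0")
  case True
  then have "(1 - p) * a\<^sup>2 = 0" "p * b\<^sup>2 = 0"
    using assms by (auto simp: s_def add_nonneg_eq_0_iff)
  then show ?thesis by (auto simp: True)
next
  case False
  then have s: "s > 0" using assms by (simp add: s_def order_less_le)
  have log: "x * ln x \<le> x * ln s + x\<^sup>2 / s - x" if "x \<ge> 0" for x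
  proof (cases "x = 0")
    case False
    then have x: "x > 0" using that by simp
    have "ln (x / s) \<le> x / s - 1" using x s by (intro ln_le_minus_one) simp
    then have "x * (ln x - ln s) \<le> x * (x / s - 1)" using x s by (simp add: ln_div)
    then show ?thesis by (simp add: algebra_simps power2_eq_square)
  qed simp
  have alg: "(1 - p) * (a\<^sup>2 * L + A / s - a\<^sup>2) + p * (b\<^sup>2 * L + B / s - b\<^sup>2)
      = s * L + ((1 - p) * A + p * B - s\<^sup>2) / s" for A B L
  proof -
    have "((1 - p) * A + p * B - s\<^sup>2) / s = (1 - p) * (A / s) + p * (B / s) - s"
      using s by (simp add: add_divide_distrib diff_divide_distrib power2_eq_square)
    moreover have "s * L = (1 - p) * a\<^sup>2 * L + p * b\<^sup>2 * L" by (simp add: s_def algebra_simps)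
    moreover have "(1 - p) * a\<^sup>2 + p * b\<^sup>2 = s" by (simp add: s_def)
    ultimately show ?thesis by (simp add: algebra_simps)
  qed
  have "(1 - p) * (a\<^sup>2 * ln (a\<^sup>2)) + p * (b\<^sup>2 * ln (b\<^sup>2)) \<le>
    (1 - p) * (a\<^sup>2 * ln s + (a\<^sup>2)\<^sup>2 / s - a\<^sup>2) + p * (b\<^sup>2 * ln s + (b\<^sup>2)\<^sup>2 / s - b\<^sup>2)"
    using assms by (intro add_mono mult_left_mono log) auto
  also have "\<dots> = s * ln s + ((1 - p) * (a\<^sup>2)\<^sup>2 + p * (b\<^sup>2)\<^sup>2 - s\<^sup>2) / s"
    by (rule alg)
  \<comment> \<open>The left side is the variance p (1 - p) (a^2 - b^2)^2, and p (1 - p) (a + b)^2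
    equals s - ((1 - p) a - p b)^2, which is at most \<open>s\<close>.\<close>
  also have "(1 - p) * (a\<^sup>2)\<^sup>2 + p * (b\<^sup>2)\<^sup>2 - s\<^sup>2 = (a - b)\<^sup>2 * (s - ((1 - p) * a - p * b)\<^sup>2)"
    by (simp add: s_def power2_eq_square algebra_simps)
  also have "\<dots> / s \<le> (a - b)\<^sup>2"
    using s by (simp add: divide_le_eq mult_left_mono)
  finally show ?thesis by simp
qed

text \<open>A form of Cauchy-Schwarz. In the log-Sobolev induction it compares the norms on two
  halves of the cube with the energy across them.\<close>

lemma cube_exp_L2_reverse_triangle:
  assumes "0 \<le> p" "p \<le> 1"
  shows "(sqrt (cube_exp p n (\<lambda>E. (f E)\<^sup>2)) - sqrt (cube_exp p n (\<lambda>E. (g E)\<^sup>2)))\<^sup>2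
    \<le> cube_exp p n (\<lambda>E. (g E - f E)\<^sup>2)"
proof -
  let ?X = "cube_exp p n (\<lambda>E. (f E)\<^sup>2)" and ?Y = "cube_exp p n (\<lambda>E. (g E)\<^sup>2)"
    and ?Z = "cube_exp p n (\<lambda>E. f E * g E)"
  have nn: "?X \<ge> 0" "?Y \<ge> 0" using assms by (auto intro!: cube_exp_nonneg)
  have quad: "?X * x\<^sup>2 - 2 * ?Z * (x * y) + ?Y * y\<^sup>2 \<ge> 0" for x y
  proof -
    have "0 \<le> cube_exp p n (\<lambda>E. (x * f E - y * g E)\<^sup>2)"
      using assms by (auto intro!: cube_exp_nonneg)
    also have "\<dots> = cube_exp p n (\<lambda>E. x\<^sup>2 * (f E)\<^sup>2 - (2 * x * y) * (f E * g E) + y\<^sup>2 * (g E)\<^sup>2)"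
      by (intro cube_exp_cong) (simp add: power2_eq_square algebra_simps)
    also have "\<dots> = x\<^sup>2 * ?X - (2 * x * y) * ?Z + y\<^sup>2 * ?Y"
      by (simp add: cube_exp_add cube_exp_diff cube_exp_cmult)
    finally show ?thesis by (simp add: algebra_simps)
  qed
  have "?Z \<le> sqrt ?X * sqrt ?Y"
  proof (cases "?X = 0 \<or> ?Y = 0")
    case False
    \<comment> \<open>Each function is weighted by the norm of the other; dividing by the product of
      the norms needs both to be nonzero.\<close>
    have "2 * ?Z * (sqrt ?Y * sqrt ?X) \<le> 2 * (?X * ?Y)"
      using quad[of "sqrt ?Y" "sqrt ?X"] nn by simp
    also have "\<dots> = 2 * (sqrt ?X * sqrt ?Y) * (sqrt ?Y * sqrt ?X)"
      using nn by (simp add: algebra_simps)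
    finally show ?thesis using False nn by (simp add: mult_le_cancel_right)
  next
    case True
    \<comment> \<open>If one norm is zero, the quadratic form is linear in one variable, and a
      positive \<open>?Z\<close> would make it negative at the points chosen below.\<close>
    have "?Z \<le> 0"
    proof (rule ccontr)
      assume "\<not> ?Z \<le> 0"
      then have Z: "?Z > 0" by simp
      show False using True
      proof
        assume "?X = 0"
        have "?Y * ?Z\<^sup>2 * 1 - 2 * (?Y + 1) * ?Z\<^sup>2 \<ge> 0"
          using quad[of "?Y + 1" "?Z"] \<open>?X = 0\<close> by (simp add: algebra_simps power2_eq_square)
        moreover have "?Y * ?Z\<^sup>2 * 1 - 2 * (?Y + 1) * ?Z\<^sup>2 = - ((?Y + 2) * ?Z\<^sup>2)"
          by (simp add: algebra_simps)
        moreover have "(?Y + 2) * ?Z\<^sup>2 > 0" using nn Z by simp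
        ultimately show False by linarith
      next
        assume "?Y = 0"
        have "?X * ?Z\<^sup>2 * 1 - 2 * (?X + 1) * ?Z\<^sup>2 \<ge> 0"
          using quad[of "?Z" "?X + 1"] \<open>?Y = 0\<close> by (simp add: algebra_simps power2_eq_square)
        moreover have "?X * ?Z\<^sup>2 * 1 - 2 * (?X + 1) * ?Z\<^sup>2 = - ((?X + 2) * ?Z\<^sup>2)"
          by (simp add: algebra_simps)
        moreover have "(?X + 2) * ?Z\<^sup>2 > 0" using nn Z by simp
        ultimately show False by linarith
      qed
    qed
    then show ?thesis using True by auto
  qed
  moreover have "cube_exp p n (\<lambda>E. (g E - f E)\<^sup>2) = ?X - 2 * ?Z + ?Y"
  proof -
    have "cube_exp p n (\<lambda>E. (g E - f E)\<^sup>2) = cube_exp p n (\<lambda>E. (f E)\<^sup>2 - 2 * (f E * g E) + (g E)\<^sup>2)"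
      by (intro cube_exp_cong) (simp add: power2_eq_square algebra_simps)
    then show ?thesis by (simp add: cube_exp_add cube_exp_diff cube_exp_cmult)
  qed
  ultimately show ?thesis using nn by (simp add: power2_diff algebra_simps)
qed

text \<open>Tensorisation by induction on \<open>n\<close>. The hypothesis handles each half; the
  two-point inequality is applied to the L2 norms \<open>sqrt s\<close> and \<open>sqrt t\<close> of
  the halves, and the reverse triangle inequality turns their difference into energy in the new
  direction.\<close>

lemma cube_log_sobolev:
  assumes "0 \<le> p" "p \<le> 1"
  defines "X \<equiv> \<lambda>n g. cube_exp p n (\<lambda>E. (g E)\<^sup>2)"
  shows "cube_exp p n (\<lambda>E. (g E)\<^sup>2 * ln ((g E)\<^sup>2)) \<le> (\<Sum>j<n. X n (coord_diff j g)) + X n g * ln (X n g)"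
proof (induction n arbitrary: g)
  case 0
  then show ?case by (simp add: X_def)
next
  case (Suc n)
  let ?g1 = "\<lambda>E. g (insert n E)"
  define s where "s = X n g"
  define t where "t = X n ?g1"
  have st: "s \<ge> 0" "t \<ge> 0" unfolding s_def t_def X_def using assms by (auto intro!: cube_exp_nonneg)
  have ins: "(\<lambda>E. coord_diff j g (insert n E)) = coord_diff j ?g1" if "j < n" for j
    using that by (auto simp: coord_diff_def fun_eq_iff insert_commute insert_Diff_if)
  have last: "X (Suc n) (coord_diff n g) = cube_exp p n (\<lambda>E. (?g1 E - g E)\<^sup>2)"
  proof -
    have 1: "cube_exp p n (\<lambda>E. (coord_diff n g E)\<^sup>2) = cube_exp p n (\<lambda>E. (?g1 E - g E)\<^sup>2)"
      by (intro cube_exp_cong) (auto simp: coord_diff_def Diff_singleton_lessThan)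
    have 2: "cube_exp p n (\<lambda>E. (coord_diff n g (insert n E))\<^sup>2) = cube_exp p n (\<lambda>E. (?g1 E - g E)\<^sup>2)"
      by (intro cube_exp_cong) (auto simp: coord_diff_def Diff_singleton_lessThan)
    show ?thesis by (simp add: X_def cube_exp_Suc 1 2 algebra_simps)
  qed
  have step: "X (Suc n) (coord_diff j g) = (1 - p) * X n (coord_diff j g) + p * X n (coord_diff j ?g1)" if "j < n" for j
    by (simp add: X_def cube_exp_Suc ins[OF that, symmetric])
  have "cube_exp p (Suc n) (\<lambda>E. (g E)\<^sup>2 * ln ((g E)\<^sup>2)) \<le>
      (1 - p) * ((\<Sum>j<n. X n (coord_diff j g)) + s * ln s) +
      p * ((\<Sum>j<n. X n (coord_diff j ?g1)) + t * ln t)"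
    unfolding cube_exp_Suc s_def t_def using assms(1,2) Suc.IH[of g] Suc.IH[of ?g1]
    by (intro add_mono mult_left_mono) auto
  also have "\<dots> = (\<Sum>j<n. X (Suc n) (coord_diff j g)) + ((1 - p) * (s * ln s) + p * (t * ln t))"
  proof -
    have "(\<Sum>j<n. X (Suc n) (coord_diff j g)) =
        (1 - p) * (\<Sum>j<n. X n (coord_diff j g)) + p * (\<Sum>j<n. X n (coord_diff j ?g1))"
      by (simp add: step sum.distrib sum_distrib_left)
    then show ?thesis by (simp add: algebra_simps)
  qed
  also have "(1 - p) * (s * ln s) + p * (t * ln t) \<le>
      (sqrt s - sqrt t)\<^sup>2 + X (Suc n) g * ln (X (Suc n) g)"
    using two_point_log_sobolev[OF assms(1,2), of "sqrt s" "sqrt t"] st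
    by (simp add: X_def cube_exp_Suc s_def t_def)
  also have "(sqrt s - sqrt t)\<^sup>2 \<le> X (Suc n) (coord_diff n g)"
    unfolding last unfolding s_def t_def X_def by (rule cube_exp_L2_reverse_triangle) fact+
  finally show ?case by simp
qed

text \<open>The constant \<open>u\<close> plays the role of the slope of a tangent to the convex entropy
  function; optimising over it would give \<open>s ln (s / \<ell>\<^sup>2)\<close> on the left-hand side, where
  \<open>\<ell>\<close> is the first absolute moment and \<open>s\<close> the second moment of \<open>g\<close>.\<close>
lemma cube_second_moment_le_energy:
  fixes n :: nat
  assumes "0 \<le> p" "p \<le> 1" "u > 0"
  defines "X \<equiv> \<lambda>g. cube_exp p n (\<lambda>E. (g E)\<^sup>2)"
  shows "X g * ln u \<le> (\<Sum>j<n. X (coord_diff j g)) + u * (cube_exp p n (\<lambda>E. \<bar>g E\<bar>))\<^sup>2"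
proof (cases "X g = 0")
  case True
  have "(\<Sum>j<n. X (coord_diff j g)) \<ge> 0" unfolding X_def
    using assms by (auto intro!: sum_nonneg cube_exp_nonneg)
  then show ?thesis using assms(3) by (simp add: True)
next
  case False
  define s where "s = X g"
  define l where "l = cube_exp p n (\<lambda>E. \<bar>g E\<bar>)"
  have "s \<ge> 0" unfolding s_def X_def using assms by (auto intro!: cube_exp_nonneg)
  then have s: "s > 0" using False s_def by simp
  have "l \<ge> 0" unfolding l_def using assms by (auto intro!: cube_exp_nonneg)
  have "l > 0"
  proof (rule ccontr)
    assume "\<not> l > 0"
    then have "l = 0" using \<open>l \<ge> 0\<close> by simp
    then have "\<forall>E\<in>Pow {..<n}. p ^ card E * (1 - p) ^ (n - card E) * \<bar>g E\<bar> = 0"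
      unfolding l_def cube_exp_def using assms by (subst (asm) sum_nonneg_eq_0_iff) auto
    then have "s = 0" unfolding s_def X_def cube_exp_def by (intro sum.neutral) auto
    then show False using s by simp
  qed
  \<comment> \<open>The bound \<open>log\<close> below is tangent to
    \<open>x\<^sup>2 * ln (x\<^sup>2)\<close> at |x| = t. With t = s / l the terms 2 s and 2 t l
    cancel after integration.\<close>
  define t where "t = s / l"
  have t: "t > 0" using s \<open>l > 0\<close> by (simp add: t_def)
  have log: "2 * ln t * x\<^sup>2 + 2 * x\<^sup>2 - 2 * t * \<bar>x\<bar> \<le> x\<^sup>2 * ln (x\<^sup>2)" for x :: real
  proof (cases "x = 0")
    case False
    have "ln (t / \<bar>x\<bar>) \<le> t / \<bar>x\<bar> - 1" using False t by (intro ln_le_minus_one) simp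
    then have "x\<^sup>2 * (ln t - ln \<bar>x\<bar>) \<le> x\<^sup>2 * (t / \<bar>x\<bar> - 1)" 
      using False t by (simp add: ln_div mult_left_mono)
    moreover have "x\<^sup>2 * (t / \<bar>x\<bar> - 1) = t * \<bar>x\<bar> - x\<^sup>2"
      using False by (simp add: field_simps power2_eq_square abs_mult_self_eq flip: abs_mult)
    moreover have "ln (x\<^sup>2) = 2 * ln \<bar>x\<bar>"
      using False ln_realpow[of "\<bar>x\<bar>" 2] by simp
    ultimately show ?thesis by (simp add: algebra_simps)
  qed simp
  have "2 * ln t * s + 2 * s - 2 * t * l = cube_exp p n (\<lambda>E. 2 * ln t * (g E)\<^sup>2 + 2 * (g E)\<^sup>2 - 2 * t * \<bar>g E\<bar>)"
    by (simp add: cube_exp_add cube_exp_diff cube_exp_cmult s_def l_def X_def)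
  also have "\<dots> \<le> cube_exp p n (\<lambda>E. (g E)\<^sup>2 * ln ((g E)\<^sup>2))"
    using assms by (intro cube_exp_mono log) auto
  also have "\<dots> \<le> (\<Sum>j<n. X (coord_diff j g)) + s * ln s"
    unfolding s_def X_def using assms by (intro cube_log_sobolev) auto
  finally have "s * (2 * ln t - ln s) \<le> (\<Sum>j<n. X (coord_diff j g))"
    using \<open>l > 0\<close> by (simp add: t_def algebra_simps)
  moreover have t_eq: "2 * ln t - ln s = ln (s / l\<^sup>2)"
    using s \<open>l > 0\<close> by (simp add: t_def ln_div ln_realpow)
  ultimately have "s * ln (s / l\<^sup>2) \<le> (\<Sum>j<n. X (coord_diff j g))"
    by (simp only: t_eq)
  \<comment> \<open>A second use of \<open>ln y \<le> y - 1\<close> trades the unknown ratio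
    \<open>s / l\<^sup>2\<close> for the free constant \<open>u\<close>.\<close>
  moreover have "s * ln u \<le> s * ln (s / l\<^sup>2) + u * l\<^sup>2"
  proof -
    have "ln (u * l\<^sup>2 / s) \<le> u * l\<^sup>2 / s - 1"
      using s \<open>l > 0\<close> \<open>u > 0\<close> by (intro ln_le_minus_one) simp
    moreover have "ln (u * l\<^sup>2 / s) = ln u - ln (s / l\<^sup>2)"
      using s \<open>l > 0\<close> \<open>u > 0\<close> by (simp add: ln_div ln_mult)
    ultimately have "s * (ln u - ln (s / l\<^sup>2)) \<le> s * (u * l\<^sup>2 / s - 1)"
      using s by (intro mult_left_mono) auto
    then show ?thesis using s by (simp add: algebra_simps)
  qed
  ultimately show ?thesis unfolding s_def l_def by linarith
qed

section \<open>Martingale differences and the influence inequality\<close>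

primrec prefix_avg :: "real \<Rightarrow> nat \<Rightarrow> (nat set \<Rightarrow> real) \<Rightarrow> nat set \<Rightarrow> real" where
  "prefix_avg p 0 f = f"
| "prefix_avg p (Suc k) f = coord_avg p k (prefix_avg p k f)"

text \<open>Coordinates below \<open>k\<close> are resampled and the others kept. As
  \<open>k\<close> runs from 0 to \<open>n\<close>, these conditional expectations lead from
  \<open>f\<close> to its mean: the Doob martingale read backwards.\<close>

lemma prefix_avg_eq_cube_exp:
  "prefix_avg p k f E = cube_exp p k (\<lambda>S. f (S \<union> (E - {..<k})))"
proof (induction k arbitrary: E)
  case (Suc k)
  have "cube_exp p k (\<lambda>S. f (S \<union> (E - {k} - {..<k}))) = cube_exp p k (\<lambda>S. f (S \<union> (E - {..<Suc k})))"
    by (intro cube_exp_cong arg_cong[where f = f]) (auto simp: less_Suc_eq)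
  moreover have "cube_exp p k (\<lambda>S. f (S \<union> (insert k E - {..<k}))) = cube_exp p k (\<lambda>S. f (insert k S \<union> (E - {..<Suc k})))"
    by (intro cube_exp_cong arg_cong[where f = f]) (auto simp: less_Suc_eq)
  ultimately show ?case by (simp add: coord_avg_def Suc.IH cube_exp_Suc)
qed simp

lemma prefix_avg_full: "E \<subseteq> {..<n} \<Longrightarrow> prefix_avg p n f E = cube_exp p n f"
  unfolding prefix_avg_eq_cube_exp by (intro cube_exp_cong) (auto intro!: arg_cong[where f = f])

text \<open>At \<open>k = i\<close> this bounds the first moment of the \<open>i\<close>-th
  martingale difference by that of the derivative of \<open>f\<close> itself.\<close>

lemma coord_diff_prefix_avg: "k \<le> i \<Longrightarrow> coord_diff i (prefix_avg p k f) = prefix_avg p k (coord_diff i f)"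
  by (induction k) (auto simp: coord_diff_avg_commute)

lemma cube_exp_abs_prefix_avg_le:
  assumes "k \<le> n" "0 \<le> p" "p \<le> 1"
  shows "cube_exp p n (\<lambda>E. \<bar>prefix_avg p k f E\<bar>) \<le> cube_exp p n (\<lambda>E. \<bar>f E\<bar>)"
  using assms(1)
proof (induction k)
  case (Suc k)
  then show ?case using cube_exp_abs_coord_avg_le[of k n p "prefix_avg p k f"] assms by simp
qed simp

text \<open>The argument of Falik and Samorodnitsky: the log-Sobolev inequality is applied to each
  martingale difference of \<open>f\<close>, and both the variance and the energy are additive over these.\<close>
lemma cube_variance_le_energy_influences:
  assumes "0 \<le> p" "p \<le> 1" "u > 0"
  shows "(cube_exp p n (\<lambda>E. (f E)\<^sup>2) - (cube_exp p n f)\<^sup>2) * ln u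
    \<le> (\<Sum>j<n. cube_exp p n (\<lambda>E. (coord_diff j f E)\<^sup>2))
      + u * (\<Sum>j<n. (cube_exp p n (\<lambda>E. \<bar>coord_diff j f E\<bar>))\<^sup>2)"
proof -
  define X where "X g = cube_exp p n (\<lambda>E. (g E)\<^sup>2)" for g
  define W where "W g = (\<Sum>j<n. X (coord_diff j g))" for g
  define A where "A k = prefix_avg p k f" for k
  define d where "d k E = A k E - A (Suc k) E" for k E
  define L where "L j = cube_exp p n (\<lambda>E. \<bar>coord_diff j f E\<bar>)" for j
  have X_step: "X (A k) = X (d k) + X (A (Suc k))" if "k < n" for k
    unfolding X_def d_def A_def prefix_avg.simps using that by (intro cube_exp_square_coord_avg)
  \<comment> \<open>Energy splits like the second moment. In direction \<open>k\<close> all of it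
    goes to \<open>d k\<close>, as averaging removes the dependence on \<open>k\<close>; any other
    derivative commutes with the average, so Pythagoras applies.\<close>
  have W_step: "W (A k) = W (d k) + W (A (Suc k))" if "k < n" for k
  proof -
    have "X (coord_diff j (A k)) = X (coord_diff j (d k)) + X (coord_diff j (A (Suc k)))" if "j < n" for j
    proof (cases "j = k")
      case True
      have "coord_diff j (d k) = coord_diff j (A k)" "coord_diff j (A (Suc k)) = (\<lambda>E. 0)"
        unfolding d_def coord_diff_diff by (simp_all add: A_def True coord_diff_avg_same)
      then show ?thesis by (simp add: X_def)
    next
      case False
      then have "coord_diff j (A (Suc k)) = coord_avg p k (coord_diff j (A k))"
        by (simp add: A_def coord_diff_avg_commute)
      then show ?thesis
        unfolding d_def coord_diff_diff X_def using \<open>k < n\<close>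
        by (simp only: cube_exp_square_coord_avg[of k n p "coord_diff j (A k)"])
    qed
    then show ?thesis by (simp add: W_def sum.distrib)
  qed
  \<comment> \<open>After \<open>k\<close> martingale differences, \<open>A k\<close> holds the
    second moment and the energy not yet spent. At \<open>k = n\<close> these are the squared mean
    and a nonnegative term that is dropped.\<close>
  have tele: "X f * ln u \<le> X (A k) * ln u + (W f - W (A k)) + u * (\<Sum>j<k. (L j)\<^sup>2)" if "k \<le> n" for k
    using that
  proof (induction k)
    case 0
    then show ?case by (simp add: A_def)
  next
    case (Suc k)
    then have "k < n" by simp
    have "cube_exp p n (\<lambda>E. \<bar>d k E\<bar>) \<le> cube_exp p n (\<lambda>E. \<bar>coord_diff k (A k) E\<bar>)"
      unfolding d_def A_def prefix_avg.simps using \<open>k < n\<close> assms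
      by (intro cube_exp_abs_minus_coord_avg_le) auto
    also have "\<dots> \<le> L k" unfolding L_def A_def coord_diff_prefix_avg[OF order_refl]
      using \<open>k < n\<close> assms by (intro cube_exp_abs_prefix_avg_le) auto
    finally have "(cube_exp p n (\<lambda>E. \<bar>d k E\<bar>))\<^sup>2 \<le> (L k)\<^sup>2"
      using assms by (intro power_mono cube_exp_nonneg) auto
    then have "u * (cube_exp p n (\<lambda>E. \<bar>d k E\<bar>))\<^sup>2 \<le> u * (L k)\<^sup>2" using assms by simp
    moreover have "X (d k) * ln u \<le> W (d k) + u * (cube_exp p n (\<lambda>E. \<bar>d k E\<bar>))\<^sup>2"
      unfolding W_def X_def using assms by (intro cube_second_moment_le_energy) auto
    ultimately show ?case
      using Suc X_step[OF \<open>k < n\<close>] W_step[OF \<open>k < n\<close>] by (simp add: algebra_simps)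
  qed
  have "X (A n) = (cube_exp p n f)\<^sup>2"
  proof -
    have "X (A n) = cube_exp p n (\<lambda>E. (cube_exp p n f)\<^sup>2)"
      unfolding X_def A_def by (intro cube_exp_cong) (simp add: prefix_avg_full)
    then show ?thesis by simp
  qed
  moreover have "W (A n) \<ge> 0"
    unfolding W_def X_def using assms by (auto intro!: sum_nonneg cube_exp_nonneg)
  ultimately show ?thesis using tele[of n]
    by (simp add: X_def W_def L_def algebra_simps)
qed

subsection \<open>Linear codes on the erasure channel\<close>

text \<open>A binary linear code is identified with the family of supports of its codewords. Position
  \<open>i\<close> is ambiguous if its bit is not determined by the unerased positions other than \<open>i\<close>, where
  \<open>E\<close> is the set of erased positions; the expectation of \<open>ambiguity L i\<close> is the EXIT function.\<close>
definition ambiguity :: "nat set set \<Rightarrow> nat \<Rightarrow> nat set \<Rightarrow> real" where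
  "ambiguity L i E = of_bool (\<exists>c\<in>L. i \<in> c \<and> c \<subseteq> insert i E)"

locale support_code =
  fixes L :: "nat set set" and N :: nat
  assumes subset_L: "c \<in> L \<Longrightarrow> c \<subseteq> {..<N}"
    and empty_L: "{} \<in> L"
    and sym_diff_L: "c \<in> L \<Longrightarrow> d \<in> L \<Longrightarrow> (c - d) \<union> (d - c) \<in> L"
begin

lemma finite_L: "finite L"
  using subset_L by (intro finite_subset[of L "Pow {..<N}"]) auto

lemma ambiguity_range: "0 \<le> ambiguity L i E" "ambiguity L i E \<le> 1"
  by (auto simp: ambiguity_def)

lemma ambiguity_mono: "E \<subseteq> E' \<Longrightarrow> ambiguity L i E \<le> ambiguity L i E'"
  unfolding ambiguity_def by (auto; blast)

text \<open>A derivative with values 0 and 1 equals its square and its absolute value, so energies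
  and first moments are both influences.\<close>

lemma coord_diff_ambiguity_cases: "coord_diff j (ambiguity L i) E \<in> {0, 1}"
proof -
  have "ambiguity L i (E - {j}) \<le> ambiguity L i (insert j E)"
    by (rule ambiguity_mono) auto
  then show ?thesis by (auto simp: coord_diff_def ambiguity_def split: if_splits)
qed

lemma coord_diff_ambiguity_same: "coord_diff i (ambiguity L i) = (\<lambda>E. 0)"
  by (simp add: coord_diff_def ambiguity_def fun_eq_iff)

text \<open>If some codeword \<open>b\<close> through \<open>j\<close> lies in
  \<open>insert j E\<close>, adding \<open>b\<close> exchanges the codewords there that avoid
  \<open>j\<close> with those that contain it.\<close>

lemma card_subcode_insert:
  "real (card {c\<in>L. c \<subseteq> insert j E}) =
   real (card {c\<in>L. c \<subseteq> E - {j}}) * (if ambiguity L j E = 1 then 2 else 1)"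
proof (cases "ambiguity L j E = 1")
  case True
  then obtain b where b: "b \<in> L" "j \<in> b" "b \<subseteq> insert j E"
    by (auto simp: ambiguity_def split: if_splits)
  let ?A = "{c\<in>L. c \<subseteq> E - {j}}" and ?B = "{c\<in>L. c \<subseteq> insert j E \<and> j \<in> c}"
  let ?t = "\<lambda>c. (c - b) \<union> (b - c)"
  have "bij_betw ?t ?A ?B"
  proof (rule bij_betw_byWitness[where f' = ?t])
    show "?t ` ?A \<subseteq> ?B" using b sym_diff_L by auto
    show "?t ` ?B \<subseteq> ?A" using b sym_diff_L by auto
  qed auto
  then have "card ?A = card ?B" by (rule bij_betw_same_card)
  moreover have "{c\<in>L. c \<subseteq> insert j E} = ?A \<union> ?B" by auto
  moreover have "card (?A \<union> ?B) = card ?A + card ?B"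
    using finite_L by (intro card_Un_disjoint) auto
  ultimately show ?thesis using True by simp
next
  case False
  then have "\<not> (\<exists>c\<in>L. j \<in> c \<and> c \<subseteq> insert j E)"
    by (auto simp: ambiguity_def split: if_splits)
  then have "{c\<in>L. c \<subseteq> insert j E} = {c\<in>L. c \<subseteq> E - {j}}" by auto
  then show ?thesis using False by simp
qed

text \<open>The differential form of the area theorem: by the derivative formula, the EXIT functions
  sum to the derivative of the expected dimension of the subcode supported on the erasures.\<close>

lemma coord_diff_log_card_subcode:
  "coord_diff j (\<lambda>E. log 2 (real (card {c\<in>L. c \<subseteq> E}))) E = ambiguity L j E"
proof -
  have "{} \<in> {c\<in>L. c \<subseteq> E - {j}}" using empty_L by auto
  then have "card {c\<in>L. c \<subseteq> E - {j}} > 0"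
    using finite_L by (auto simp: card_gt_0_iff)
  moreover have "ambiguity L j E = 1 \<or> ambiguity L j E = 0" by (auto simp: ambiguity_def)
  ultimately show ?thesis
    unfolding coord_diff_def card_subcode_insert by (auto simp: log_mult)
qed

text \<open>Each position of a codeword covered by the erasures is ambiguous, with that codeword as
  witness.\<close>

lemma block_le_sum_exit:
  assumes "0 \<le> p" "p \<le> 1" and d: "\<And>c. c \<in> L \<Longrightarrow> c \<noteq> {} \<Longrightarrow> d \<le> card c"
  shows "real d * cube_exp p N (\<lambda>E. of_bool (\<exists>c\<in>L. c \<noteq> {} \<and> c \<subseteq> E))
    \<le> (\<Sum>i<N. cube_exp p N (ambiguity L i))"
  unfolding cube_exp_cmult[symmetric] cube_exp_sum[symmetric]
proof (rule cube_exp_mono)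
  fix E assume "E \<subseteq> {..<N}"
  show "real d * of_bool (\<exists>c\<in>L. c \<noteq> {} \<and> c \<subseteq> E) \<le> (\<Sum>i<N. ambiguity L i E)"
  proof (cases "\<exists>c\<in>L. c \<noteq> {} \<and> c \<subseteq> E")
    case True
    then obtain c where c: "c \<in> L" "c \<noteq> {}" "c \<subseteq> E" by auto
    have "real d \<le> (\<Sum>i\<in>c. 1)" using d[OF c(1,2)] by simp
    also have "\<dots> = (\<Sum>i\<in>c. ambiguity L i E)"
      using c by (intro sum.cong) (auto simp: ambiguity_def)
    also have "\<dots> \<le> (\<Sum>i<N. ambiguity L i E)"
      using subset_L[OF c(1)] ambiguity_range by (intro sum_mono2) auto
    finally show ?thesis using True by simp
  qed (auto intro!: sum_nonneg simp: ambiguity_range)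
qed (use assms in auto)

text \<open>By linearity failure does not depend on the word sent: two codewords that agree off
  \<open>E\<close> differ by a nonzero codeword inside \<open>E\<close>.\<close>

lemma block_error_prob_eq:
  "block_error_prob ((\<lambda>c i. of_bool (i \<in> c)) ` L) N p =
    cube_exp p N (\<lambda>E. of_bool (\<exists>c\<in>L. c \<noteq> {} \<and> c \<subseteq> E))"
proof -
  define word :: "nat set \<Rightarrow> nat \<Rightarrow> bit" where "word c = (\<lambda>i. of_bool (i \<in> c))" for c
  have word_eq: "word a i = word b i \<longleftrightarrow> (i \<in> a \<longleftrightarrow> i \<in> b)" for a b i
    by (simp add: word_def)
  have inj: "inj_on word L"
    by (auto simp: inj_on_def fun_eq_iff word_eq)
  have key: "(\<exists>x'\<in>word ` L. x' \<noteq> word a \<and> (\<forall>i\<in>{..<N} - E. x' i = word a i)) \<longleftrightarrow>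
      (\<exists>c\<in>L. c \<noteq> {} \<and> c \<subseteq> E)" if a: "a \<in> L" for a E
  proof
    assume "\<exists>x'\<in>word ` L. x' \<noteq> word a \<and> (\<forall>i\<in>{..<N} - E. x' i = word a i)"
    then obtain b where b: "b \<in> L" "word b \<noteq> word a" "\<forall>i\<in>{..<N} - E. word b i = word a i"
      by auto
    have "(a - b) \<union> (b - a) \<noteq> {}" using b(2) by auto
    moreover have "(a - b) \<union> (b - a) \<subseteq> E"
      using b(3) subset_L[OF a] subset_L[OF b(1)] unfolding word_eq by fast
    ultimately show "\<exists>c\<in>L. c \<noteq> {} \<and> c \<subseteq> E"
      by (intro bexI[OF _ sym_diff_L[OF a b(1)]] conjI)
  next
    assume "\<exists>c\<in>L. c \<noteq> {} \<and> c \<subseteq> E"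
    then obtain c where c: "c \<in> L" "c \<noteq> {}" "c \<subseteq> E" by auto
    let ?b = "(a - c) \<union> (c - a)"
    have "word ?b \<noteq> word a" using c(2) by (auto simp: fun_eq_iff word_eq)
    moreover have "\<forall>i\<in>{..<N} - E. word ?b i = word a i" using c(3) unfolding word_eq by blast
    ultimately show "\<exists>x'\<in>word ` L. x' \<noteq> word a \<and> (\<forall>i\<in>{..<N} - E. x' i = word a i)"
      by (intro bexI[OF _ imageI[OF sym_diff_L[OF a c(1)]]] conjI)
  qed
  have L: "card L > 0" using finite_L empty_L by (auto simp: card_gt_0_iff)
  have "block_error_prob (word ` L) N p = (1 / real (card L)) *
      (\<Sum>a\<in>L. cube_exp p N (\<lambda>E. of_bool (\<exists>c\<in>L. c \<noteq> {} \<and> c \<subseteq> E)))"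
    unfolding block_error_prob_def cube_exp_def card_image[OF inj] sum.reindex[OF inj] o_def
    by (intro arg_cong2[where f = "(*)"] sum.cong refl) (simp only: key of_bool_def)
  then show ?thesis using L by (simp add: word_def[abs_def])
qed

end

section \<open>Doubly transitive codes: sharp threshold of the EXIT function\<close>

locale doubly_transitive_code = support_code +
  assumes N_ge_2: "N \<ge> 2"
    and doubly_transitive: "\<lbrakk>i < N; j < N; i \<noteq> j; i' < N; j' < N; i' \<noteq> j'\<rbrakk> \<Longrightarrow>
      \<exists>\<sigma>. bij_betw \<sigma> {..<N} {..<N} \<and> \<sigma> i = i' \<and> \<sigma> j = j' \<and> (\<forall>c\<in>L. \<sigma> ` c \<in> L)"
begin

lemma ambiguity_image:
  assumes \<sigma>: "bij_betw \<sigma> {..<N} {..<N}" "\<forall>c\<in>L. \<sigma> ` c \<in> L" and "i < N" "E \<subseteq> {..<N}"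
  shows "ambiguity L (\<sigma> i) (\<sigma> ` E) = ambiguity L i E"
proof -
  have inj: "inj_on \<sigma> {..<N}" using \<sigma> by (simp add: bij_betw_def)
  have "inj_on ((`) \<sigma>) L"
    using inj_on_image_Pow[OF inj] subset_L by (auto intro: inj_on_subset)
  \<comment> \<open>An injective self-map of the finite set \<open>L\<close> is onto, so mapping
    codewords to codewords suffices.\<close>
  then have surj: "(`) \<sigma> ` L = L"
    using endo_inj_surj[OF finite_L, of "(`) \<sigma>"] \<sigma>(2) by auto
  have "(\<sigma> i \<in> \<sigma> ` c \<and> \<sigma> ` c \<subseteq> insert (\<sigma> i) (\<sigma> ` E)) \<longleftrightarrow> (i \<in> c \<and> c \<subseteq> insert i E)" if "c \<in> L" for c
  proof -
    have "\<sigma> ` c \<subseteq> \<sigma> ` insert i E \<longleftrightarrow> c \<subseteq> insert i E"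
    proof -
      have "\<sigma> x \<in> \<sigma> ` insert i E \<longleftrightarrow> x \<in> insert i E" if "x \<in> c" for x
        using assms(3,4) subset_L[OF \<open>c \<in> L\<close>] that by (intro inj_on_image_mem_iff[OF inj]) auto
      then show ?thesis by blast
    qed
    moreover have "\<sigma> i \<in> \<sigma> ` c \<longleftrightarrow> i \<in> c"
      using assms(3) subset_L[OF that] by (intro inj_on_image_mem_iff[OF inj]) auto
    ultimately show ?thesis by simp
  qed
  then have "(\<exists>c\<in>(`) \<sigma> ` L. \<sigma> i \<in> c \<and> c \<subseteq> insert (\<sigma> i) (\<sigma> ` E)) \<longleftrightarrow> (\<exists>c\<in>L. i \<in> c \<and> c \<subseteq> insert i E)"
    by auto
  then show ?thesis by (simp add: ambiguity_def surj)
qed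

lemma influence_image:
  assumes \<sigma>: "bij_betw \<sigma> {..<N} {..<N}" "\<forall>c\<in>L. \<sigma> ` c \<in> L" and "i < N" "j < N"
  shows "cube_exp p N (coord_diff (\<sigma> j) (ambiguity L (\<sigma> i))) = cube_exp p N (coord_diff j (ambiguity L i))"
proof -
  have inj: "inj_on \<sigma> {..<N}" using \<sigma> by (simp add: bij_betw_def)
  have "coord_diff (\<sigma> j) (ambiguity L (\<sigma> i)) (\<sigma> ` E) = coord_diff j (ambiguity L i) E" if "E \<subseteq> {..<N}" for E
  proof -
    have "\<sigma> ` E - {\<sigma> j} = \<sigma> ` (E - {j})"
      using inj_on_image_set_diff[OF inj, of E "{j}"] that assms by auto
    moreover have "insert (\<sigma> j) (\<sigma> ` E) = \<sigma> ` insert j E" by simp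
    moreover have "insert j E \<subseteq> {..<N}" "E - {j} \<subseteq> {..<N}" using that assms by auto
    ultimately show ?thesis unfolding coord_diff_def
      using ambiguity_image[OF \<sigma> \<open>i < N\<close>] by metis
  qed
  then show ?thesis
    by (subst cube_exp_image[OF \<sigma>(1), symmetric]) (rule cube_exp_cong)
qed

lemma exit_eq:
  assumes "i < N" "j < N"
  shows "cube_exp p N (ambiguity L i) = cube_exp p N (ambiguity L j)"
proof (cases "i = j")
  case False
  obtain \<sigma> where \<sigma>: "bij_betw \<sigma> {..<N} {..<N}" "\<sigma> i = j" "\<forall>c\<in>L. \<sigma> ` c \<in> L"
    using doubly_transitive[of i j j i] assms False by auto
  have "cube_exp p N (ambiguity L i) = cube_exp p N (\<lambda>E. ambiguity L j (\<sigma> ` E))"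
    using ambiguity_image[OF \<sigma>(1,3) assms(1)] \<sigma>(2) by (intro cube_exp_cong) auto
  then show ?thesis by (simp add: cube_exp_image[OF \<sigma>(1)])
qed simp

text \<open>By \<open>exit_eq\<close>, position 0 stands for every position.\<close>

definition exit :: "real \<Rightarrow> real" where
  "exit p = cube_exp p N (ambiguity L 0)"

definition exit_deriv :: "real \<Rightarrow> real" where
  "exit_deriv p = (\<Sum>j<N. cube_exp p N (coord_diff j (ambiguity L 0)))"

lemma exit_has_derivative: "(exit has_real_derivative exit_deriv p) (at p)"
  unfolding exit_def[abs_def] exit_deriv_def by (rule cube_exp_has_real_derivative)

lemma exit_range:
  assumes "0 \<le> p" "p \<le> 1"
  shows "0 \<le> exit p" "exit p \<le> 1"
  using cube_exp_nonneg[OF assms, of N "ambiguity L 0"] ambiguity_range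
    cube_exp_mono[OF assms, of N "ambiguity L 0" "\<lambda>_. 1"] by (auto simp: exit_def)

lemma exit_deriv_nonneg:
  assumes "0 \<le> p" "p \<le> 1"
  shows "0 \<le> exit_deriv p"
proof -
  have "0 \<le> coord_diff j (ambiguity L 0) E" for j E
    using coord_diff_ambiguity_cases[of j 0 E] by auto
  then show ?thesis unfolding exit_deriv_def
    using assms by (intro sum_nonneg cube_exp_nonneg) auto
qed

lemma exit_mono:
  assumes "0 \<le> p" "p \<le> q" "q \<le> 1"
  shows "exit p \<le> exit q"
  using assms exit_has_derivative exit_deriv_nonneg
  by (intro DERIV_nonneg_imp_nondecreasing[of p q exit]) (auto intro!: exI[of _ "exit_deriv _"])

text \<open>With \<open>M = N - 1\<close> equal influences and one zero, of sum \<open>D\<close>,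
  the squares sum to D^2 / M. Taking u = sqrt M in the influence inequality leaves D + D^2 / sqrt M
  as a bound for the variance h (1 - h) times ln (sqrt M).\<close>

lemma exit_sharp_threshold:
  assumes p: "0 \<le> p" "p \<le> 1"
  shows "exit_deriv p \<ge> ln (real N - 1) / 4 * (exit p * (1 - exit p))"
proof -
  define I where "I j = cube_exp p N (coord_diff j (ambiguity L 0))" for j
  define M where "M = real N - 1"
  define s where "s = sqrt M"
  define D where "D = exit_deriv p"
  have M: "M \<ge> 1" using N_ge_2 by (simp add: M_def)
  then have s: "s \<ge> 1" by (simp add: s_def)
  have D: "D = (\<Sum>j<N. I j)" "D \<ge> 0"
    using exit_deriv_nonneg[OF p] by (simp_all add: D_def exit_deriv_def I_def)
  have I0: "I 0 = 0" by (simp add: I_def coord_diff_ambiguity_same)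
  have I1: "I j = I 1" if j: "0 < j" "j < N" for j
  proof -
    \<comment> \<open>Transitivity on pairs matters here: position 0 must stay fixed while 1 moves
      to \<open>j\<close>.\<close>
    obtain \<sigma> where \<sigma>: "bij_betw \<sigma> {..<N} {..<N}" "\<sigma> 0 = 0" "\<sigma> 1 = j" "\<forall>c\<in>L. \<sigma> ` c \<in> L"
      using doubly_transitive[of 0 1 0 j] N_ge_2 j by auto
    then show ?thesis
      using influence_image[OF \<sigma>(1,4), of 0 1 p] N_ge_2 by (simp add: I_def)
  qed
  have split: "{..<N} = insert 0 {1..<N}" using N_ge_2 by auto
  have sum_g: "(\<Sum>j<N. g (I j)) = M * g (I 1)" if "g 0 = 0" for g :: "real \<Rightarrow> real"
  proof -
    have "(\<Sum>j<N. g (I j)) = (\<Sum>j\<in>{1..<N}. g (I j))"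
      unfolding split by (simp add: I0 that)
    also have "\<dots> = (\<Sum>j\<in>{1..<N}. g (I 1))"
      by (intro sum.cong refl arg_cong[where f = g] I1) auto
    finally show ?thesis using N_ge_2 by (simp add: M_def)
  qed
  have "D = M * I 1" using sum_g[of "\<lambda>x. x"] by (simp only: D(1))
  moreover have "(\<Sum>j<N. (I j)\<^sup>2) = M * (I 1)\<^sup>2" using sum_g[of "\<lambda>x. x\<^sup>2"] by simp
  ultimately have sumsq: "(\<Sum>j<N. (I j)\<^sup>2) = D\<^sup>2 / M"
    using M by (simp add: power2_eq_square)
  have sq: "(coord_diff j (ambiguity L 0) E)\<^sup>2 = coord_diff j (ambiguity L 0) E"
    "\<bar>coord_diff j (ambiguity L 0) E\<bar> = coord_diff j (ambiguity L 0) E" for j E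
    using coord_diff_ambiguity_cases[of j 0 E] by auto
  have sq': "(ambiguity L 0 E)\<^sup>2 = ambiguity L 0 E" for E
    by (simp add: ambiguity_def)
  have "(exit p - (exit p)\<^sup>2) * ln s \<le> (\<Sum>j<N. I j) + s * (\<Sum>j<N. (I j)\<^sup>2)"
    using cube_variance_le_energy_influences[OF p, of s N "ambiguity L 0"] s
    by (simp add: sq sq' exit_def I_def)
  also have "\<dots> = D + D * (D / s)"
  proof -
    have "M = s * s" using M by (simp add: s_def)
    then show ?thesis unfolding sumsq D(1)[symmetric] using s by (simp add: power2_eq_square)
  qed
  finally have le: "(exit p - (exit p)\<^sup>2) * ln s \<le> D + D * (D / s)" .
  have V: "exit p - (exit p)\<^sup>2 = exit p * (1 - exit p)"
    by (simp add: power2_eq_square algebra_simps)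
  have V1: "0 \<le> exit p * (1 - exit p)" "exit p * (1 - exit p) \<le> 1"
    using exit_range[OF p] by (auto intro: mult_le_one)
  \<comment> \<open>For \<open>D \<le> s\<close> the quadratic term is at most \<open>D\<close>. For
    larger \<open>D\<close> the claim follows from variance at most 1 and
    \<open>ln s \<le> s - 1\<close>.\<close>
  have "exit p * (1 - exit p) * ln s \<le> 2 * D"
  proof (cases "D \<le> s")
    case True
    then have "D * (D / s) \<le> D * 1" using s D by (intro mult_left_mono) auto
    then show ?thesis using le V by simp
  next
    case False
    have "exit p * (1 - exit p) * ln s \<le> 1 * ln s" using V1 s by (intro mult_right_mono) auto
    also have "\<dots> \<le> s - 1" using s ln_le_minus_one[of s] by simp
    finally show ?thesis using False D by linarith
  qed
  moreover have "ln s = ln M / 2" using M by (simp add: s_def ln_sqrt)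
  ultimately show ?thesis by (simp add: D_def M_def algebra_simps)
qed

text \<open>Up to \<open>q\<close> the factor 1 - h is at least \<eta>, so the threshold inequality
  becomes h' \<ge> k h. Then h(x) exp (- k x) is nondecreasing, and its values at \<open>p\<close>
  and \<open>q\<close> are compared.\<close>

lemma exit_decay:
  assumes "0 \<le> p" "p \<le> q" "q \<le> 1" "exit q \<le> 1 - \<eta>" "0 \<le> \<eta>"
  shows "exit p \<le> (real N - 1) powr (- (\<eta> * (q - p) / 4))"
proof -
  define k where "k = \<eta> * ln (real N - 1) / 4"
  have ln: "ln (real N - 1) \<ge> 0" using N_ge_2 by simp
  have "exit p * exp (- k * p) \<le> exit q * exp (- k * q)"
  proof (rule DERIV_nonneg_imp_nondecreasing[OF assms(2)])
    fix x assume x: "p \<le> x" "x \<le> q"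
    have x01: "0 \<le> x" "x \<le> 1" using x assms by auto
    have "k * exit x = ln (real N - 1) / 4 * (exit x * \<eta>)" by (simp add: k_def)
    also have "\<dots> \<le> ln (real N - 1) / 4 * (exit x * (1 - exit x))"
      using exit_mono[OF x01(1) x(2) assms(3)] assms(4) ln exit_range[OF x01]
      by (intro mult_left_mono) auto
    also have "\<dots> \<le> exit_deriv x" by (rule exit_sharp_threshold[OF x01])
    finally have "0 \<le> (exit_deriv x - k * exit x) * exp (- k * x)" by simp
    moreover have "((\<lambda>x. exit x * exp (- k * x)) has_real_derivative
        (exit_deriv x - k * exit x) * exp (- k * x)) (at x)"
      by (rule derivative_eq_intros exit_has_derivative refl | simp add: algebra_simps)+
    ultimately show "\<exists>y. ((\<lambda>x. exit x * exp (- k * x)) has_real_derivative y) (at x) \<and> 0 \<le> y"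
      by blast
  qed
  also have "\<dots> \<le> 1 * exp (- k * q)" using exit_range[of q] assms by (intro mult_right_mono) auto
  finally have "exit p \<le> exp (- k * q) / exp (- k * p)" by (simp add: field_simps)
  also have "\<dots> = exp (- (\<eta> * (q - p) / 4) * ln (real N - 1))"
    unfolding exp_diff[symmetric] by (simp add: k_def field_simps)
  also have "\<dots> = (real N - 1) powr (- (\<eta> * (q - p) / 4))"
    using N_ge_2 by (simp add: powr_def)
  finally show ?thesis .
qed

text \<open>One half of the area theorem: the EXIT function integrates to the rate, and it is increasing.\<close>
lemma exit_le_rate:
  assumes "0 \<le> p" "p < 1"
  shows "(1 - p) * (real N * exit p) \<le> log 2 (real (card L))"
proof -
  \<comment> \<open>The dimension of the subcode supported on \<open>E\<close>: the number of
    information bits lost by erasing \<open>E\<close>.\<close>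
  define K where "K E = log 2 (real (card {c\<in>L. c \<subseteq> E}))" for E
  have "{c\<in>L. c \<subseteq> {..<N}} = L" using subset_L by auto
  then have K1: "cube_exp 1 N K = log 2 (real (card L))" by (simp add: cube_exp_at_1 K_def)
  have K_nonneg: "K E \<ge> 0" for E
  proof -
    have "{} \<in> {c\<in>L. c \<subseteq> E}" using empty_L by simp
    then have "card {c\<in>L. c \<subseteq> E} > 0" using finite_L by (auto simp: card_gt_0_iff)
    then show ?thesis by (simp add: K_def)
  qed
  have deriv: "((\<lambda>p. cube_exp p N K) has_real_derivative real N * exit x) (at x)" for x
  proof -
    have "coord_diff j K = ambiguity L j" for j
      unfolding K_def[abs_def] by (rule ext) (rule coord_diff_log_card_subcode)
    then have "(\<Sum>j<N. cube_exp x N (coord_diff j K)) = (\<Sum>j<N. exit x)"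
      unfolding exit_def using N_ge_2 by (intro sum.cong) (auto intro: exit_eq)
    then show ?thesis using cube_exp_has_real_derivative[of N K x] by simp
  qed
  \<comment> \<open>The mean value theorem replaces integration; monotonicity then compares
    \<open>exit z\<close> with \<open>exit p\<close>.\<close>
  obtain z where z: "p < z" "z < 1" "cube_exp 1 N K - cube_exp p N K = (1 - p) * (real N * exit z)"
    using MVT2[OF assms(2), of "\<lambda>p. cube_exp p N K" "\<lambda>x. real N * exit x"] deriv by auto
  have "(1 - p) * (real N * exit p) \<le> (1 - p) * (real N * exit z)"
    using exit_mono[of p z] z assms by (intro mult_left_mono) auto
  also have "\<dots> = cube_exp 1 N K - cube_exp p N K" using z by simp
  also have "\<dots> \<le> log 2 (real (card L))"
    using K1 cube_exp_nonneg[of p N K] K_nonneg assms by simp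
  finally show ?thesis .
qed

text \<open>At the midpoint \<open>q\<close> of \<open>p\<close> and \<open>1 - r\<close>, the area
  bound keeps \<open>exit q\<close> at most \<open>r / (1 - q)\<close>, which is below 1. This gap
  drives the decay from \<open>q\<close> down to \<open>p\<close>.\<close>

theorem block_failure_bound:
  assumes p: "0 \<le> p" "p < 1 - r" and "0 \<le> r"
    and rate: "log 2 (real (card L)) \<le> r * real N"
    and d: "\<And>c. c \<in> L \<Longrightarrow> c \<noteq> {} \<Longrightarrow> d \<le> card c"
  defines "q \<equiv> (p + (1 - r)) / 2"
  shows "real d * cube_exp p N (\<lambda>E. of_bool (\<exists>c\<in>L. c \<noteq> {} \<and> c \<subseteq> E))
    \<le> real N * (real N - 1) powr (- ((1 - r / (1 - q)) * (q - p) / 4))"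
proof -
  have q: "p < q" "q < 1 - r" using p by (auto simp: q_def)
  have "real d * cube_exp p N (\<lambda>E. of_bool (\<exists>c\<in>L. c \<noteq> {} \<and> c \<subseteq> E))
      \<le> (\<Sum>i<N. cube_exp p N (ambiguity L i))"
    using p assms(3) d by (intro block_le_sum_exit) auto
  also have "\<dots> = (\<Sum>i<N. exit p)"
    unfolding exit_def using N_ge_2 by (intro sum.cong) (auto intro: exit_eq)
  also have "\<dots> = real N * exit p" by simp
  also have "\<dots> \<le> real N * (real N - 1) powr (- ((1 - r / (1 - q)) * (q - p) / 4))"
  proof (intro mult_left_mono exit_decay)
    have "real N * ((1 - q) * exit q) \<le> real N * r"
      using exit_le_rate[of q] rate q p assms(3) by (simp add: algebra_simps)
    then have "(1 - q) * exit q \<le> r" using N_ge_2 by simp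
    then have "exit q \<le> r / (1 - q)" using q assms(3) by (simp add: field_simps)
    then show "exit q \<le> 1 - (1 - r / (1 - q))" by simp
    show "0 \<le> 1 - r / (1 - q)" using q assms(3) by (simp add: field_simps)
  qed (use p q assms(3) in auto)
  finally show ?thesis .
qed

end

subsection \<open>Extended BCH codes as sets with vanishing power sums\<close>

locale primitive_field = field F for F :: "('a, 'b) ring_scheme" (structure) +
  fixes \<alpha> :: 'a and m :: nat
  assumes m_pos: "m \<ge> 1"
    and card_F: "card (carrier F) = 2 ^ m"
    and alpha_nz: "\<alpha> \<in> carrier F - {\<zero>}"
    and primitive: "carrier F - {\<zero>} = range (\<lambda>k::nat. \<alpha> [^] k)"
begin

abbreviation N :: nat where "N \<equiv> 2 ^ m"

lemma N_ge_2: "N \<ge> 2"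
  using m_pos power_increasing[of 1 m "2::nat"] by simp

lemma finite_F: "finite (carrier F)"
  using card_F card.infinite by fastforce

lemma alpha_closed [simp]: "\<alpha> \<in> carrier F"
  using alpha_nz by simp

text \<open>The additive group has order 2^m, so 2^m times one vanishes. This multiple is also the
  \<open>m\<close>-th power of \<open>t = \<one> \<oplus> \<one>\<close>, and a field has no
  nilpotent elements besides zero.\<close>

lemma char_two:
  assumes "x \<in> carrier F"
  shows "x \<oplus> x = \<zero>"
proof -
  define t where "t = \<one> \<oplus> \<one>"
  have t: "t \<in> carrier F" by (simp add: t_def)
  have pow: "[(2 ^ k :: nat)] \<cdot> \<one> = t [^] k" for k
  proof (induction k)
    case (Suc k)
    have "[(2 ^ Suc k :: nat)] \<cdot> \<one> = [(2 ^ k :: nat)] \<cdot> \<one> \<oplus> [(2 ^ k :: nat)] \<cdot> \<one>"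
      by (simp add: add.nat_pow_mult mult_2)
    also have "\<dots> = t [^] k \<otimes> t" using t by (simp add: Suc.IH t_def r_distr)
    finally show ?case by simp
  qed simp
  have "t [^] m = \<zero>"
    using add.power_order_eq_one[of \<one>] finite_F by (simp add: card_F pow flip: pow)
  have "t = \<zero>"
  proof (rule ccontr)
    assume "t \<noteq> \<zero>"
    then have "t [^] k \<noteq> \<zero>" for k :: nat
      using t by (induction k) (auto simp: integral_iff)
    then show False using \<open>t [^] m = \<zero>\<close> by blast
  qed
  then have "x \<otimes> (\<one> \<oplus> \<one>) = \<zero>" using assms by (simp add: t_def)
  then show ?thesis using assms by (simp add: r_distr)
qed

text \<open>Zero labels the last position, that of the parity bit, so that the labels exhaust the
  field and affine maps permute the positions.\<close>

definition pos :: "nat \<Rightarrow> 'a" where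
  "pos i = (if i < N - 1 then \<alpha> [^] i else \<zero>)"

lemma pos_closed [simp]: "pos i \<in> carrier F"
  by (simp add: pos_def)

lemma pos_last: "pos (N - Suc 0) = \<zero>"
  by (simp add: pos_def)

lemma alpha_power_order: "\<alpha> [^] (N - 1) = \<one>"
proof -
  have "card (Units F) = N - 1" using card_F finite_F by (simp add: field_Units)
  then show ?thesis
    using units_power_order_eq_one[of \<alpha>] alpha_nz finite_F by (simp add: field_Units)
qed

lemma pos_bij: "bij_betw pos {..<N} (carrier F)"
proof -
  have "carrier F \<subseteq> pos ` {..<N}"
  proof
    fix x assume x: "x \<in> carrier F"
    show "x \<in> pos ` {..<N}"
    proof (cases "x = \<zero>")
      case True
      then have "x = pos (N - 1)" by (simp add: pos_def)
      then show ?thesis by auto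
    next
      case False
      then obtain k :: nat where k: "x = \<alpha> [^] k" using primitive x by blast
      have "\<alpha> [^] k = \<alpha> [^] ((N - 1) * (k div (N - 1)) + k mod (N - 1))" by simp
      also have "\<dots> = (\<alpha> [^] (N - 1)) [^] (k div (N - 1)) \<otimes> \<alpha> [^] (k mod (N - 1))"
        by (simp only: nat_pow_mult[symmetric] nat_pow_pow alpha_closed)
      also have "\<dots> = \<alpha> [^] (k mod (N - 1))" by (simp only: alpha_power_order) simp
      finally have "x = pos (k mod (N - 1))" using k N_ge_2 by (simp add: pos_def)
      moreover have "k mod (N - 1) < N - 1" using N_ge_2 by (intro mod_less_divisor) simp
      ultimately show ?thesis by (intro image_eqI) auto
    qed
  qed
  then have img: "pos ` {..<N} = carrier F" by auto
  then have "inj_on pos {..<N}" using card_F by (intro eq_card_imp_inj_on) auto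
  then show ?thesis using img by (simp add: bij_betw_def)
qed

section \<open>Evaluation of binary polynomials and the generator polynomial\<close>

declare add_bit_eq_xor [simp del]

lemma bit_in_closed [simp]: "bit_in F b \<in> carrier F"
  by (simp add: bit_in_def)

lemma bit_in_simps [simp]: "bit_in F 0 = \<zero>" "bit_in F 1 = \<one>"
  by (simp_all add: bit_in_def)

lemma bit_in_add: "bit_in F (a + b) = bit_in F a \<oplus> bit_in F b"
  by (cases a; cases b) (auto simp: char_two add_bit_eq_xor)

lemma eval_in_eq_finsum:
  assumes "degree p < n" and [simp]: "x \<in> carrier F"
  shows "eval_in F p x = (\<Oplus>j\<in>{..<n}. bit_in F (coeff p j) \<otimes> x [^] j)"
  unfolding eval_in_def using assms
  by (intro add.finprod_mono_neutral_cong_left) (auto simp: coeff_eq_0)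

lemma eval_in_closed [simp]: "x \<in> carrier F \<Longrightarrow> eval_in F p x \<in> carrier F"
  unfolding eval_in_def by (intro finsum_closed) auto

lemma eval_in_add:
  assumes [simp]: "x \<in> carrier F"
  shows "eval_in F (p + q) x = eval_in F p x \<oplus> eval_in F q x"
proof -
  define n where "n = Suc (max (degree p) (degree q))"
  have n: "degree p < n" "degree q < n" "degree (p + q) < n"
    using degree_add_le_max[of p q] by (auto simp: n_def)
  show ?thesis
    unfolding n[THEN eval_in_eq_finsum, OF assms]
    by (subst finsum_addf[symmetric]) (auto intro!: finsum_cong' simp: bit_in_add l_distr)
qed

lemma eval_in_0 [simp]: "x \<in> carrier F \<Longrightarrow> eval_in F 0 x = \<zero>"
  by (simp add: eval_in_def)

lemma eval_in_pCons_0: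
  assumes [simp]: "x \<in> carrier F"
  shows "eval_in F (pCons 0 p) x = x \<otimes> eval_in F p x"
proof -
  have 1: "degree p < Suc (degree p)" "degree (pCons 0 p) < Suc (Suc (degree p))"
    using degree_pCons_le[of 0 p] by auto
  have "eval_in F (pCons 0 p) x = (\<Oplus>j\<in>{..Suc (degree p)}. bit_in F (coeff (pCons 0 p) j) \<otimes> x [^] j)"
    unfolding eval_in_eq_finsum[OF 1(2) assms] lessThan_Suc_atMost ..
  also have "\<dots> = (\<Oplus>j\<in>{..degree p}. bit_in F (coeff p j) \<otimes> x [^] Suc j)"
    by (subst finsum_Suc2) auto
  also have "\<dots> = (\<Oplus>j\<in>{..degree p}. x \<otimes> (bit_in F (coeff p j) \<otimes> x [^] j))"
    by (intro finsum_cong') (auto simp: m_ac)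
  also have "\<dots> = x \<otimes> eval_in F p x"
    unfolding eval_in_def by (intro finsum_rdistr[symmetric]) auto
  finally show ?thesis .
qed

lemma eval_in_1 [simp]: "x \<in> carrier F \<Longrightarrow> eval_in F 1 x = \<one>"
  by (simp add: eval_in_def)

lemma eval_in_mult:
  assumes [simp]: "x \<in> carrier F"
  shows "eval_in F (p * q) x = eval_in F p x \<otimes> eval_in F q x"
proof (induction p)
  case (pCons a p)
  have "eval_in F (smult a q) x = eval_in F [:a:] x \<otimes> eval_in F q x"
    by (cases a) (auto simp flip: one_pCons)
  moreover have "eval_in F (pCons a p) x = eval_in F [:a:] x \<oplus> x \<otimes> eval_in F p x"
    using eval_in_add[of x "[:a:]" "pCons 0 p"] by (simp add: eval_in_pCons_0)
  ultimately show ?case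
    by (simp add: eval_in_add eval_in_pCons_0 pCons.IH l_distr m_assoc)
qed simp

lemma eval_in_monom: "x \<in> carrier F \<Longrightarrow> eval_in F (monom 1 n) x = x [^] n"
proof (induction n)
  case (Suc n)
  then show ?case by (simp add: monom_Suc eval_in_pCons_0 m_comm)
qed simp

lemma has_bch_roots_exists: "\<exists>f. f \<noteq> 0 \<and> has_bch_roots F \<alpha> v f"
proof (intro exI conjI)
  \<comment> \<open>The polynomial x^(N-1) + 1 vanishes at every power of \<alpha>.\<close>
  let ?f = "monom 1 (N - 1) + 1 :: bit poly"
  have "coeff ?f (N - 1) = 1" using N_ge_2 by (simp add: coeff_1)
  then show "?f \<noteq> 0" by (metis coeff_0 zero_neq_one)
  show "has_bch_roots F \<alpha> v ?f"
    unfolding has_bch_roots_def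
  proof
    fix i :: nat
    have "(\<alpha> [^] i) [^] (N - 1) = (\<alpha> [^] (N - 1)) [^] i"
      using nat_pow_pow[of \<alpha> i "N - 1"] nat_pow_pow[of \<alpha> "N - 1" i] by (simp add: mult.commute)
    then show "eval_in F ?f (\<alpha> [^] i) = \<zero>"
      by (simp only: eval_in_add eval_in_monom eval_in_1 nat_pow_closed alpha_closed alpha_power_order)
        (simp add: char_two)
  qed
qed

text \<open>Division with remainder: a nonzero remainder would be a polynomial with the required
  roots and smaller degree. Thus the code depends only on the roots, not on the choice made by
  \<open>SOME\<close>.\<close>

lemma bch_gen_dvd_iff: "bch_gen F \<alpha> v dvd c \<longleftrightarrow> has_bch_roots F \<alpha> v c"
proof -
  let ?P = "\<lambda>f. f \<noteq> 0 \<and> has_bch_roots F \<alpha> v f"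
  define f where "f = bch_gen F \<alpha> v"
  have "\<exists>f. ?P f \<and> (\<forall>g. ?P g \<longrightarrow> degree f \<le> degree g)"
    using has_bch_roots_exists ex_has_least_nat[of ?P _ degree] by blast
  then have "\<exists>f. f \<noteq> 0 \<and> has_bch_roots F \<alpha> v f \<and>
      (\<forall>g. g \<noteq> 0 \<and> has_bch_roots F \<alpha> v g \<longrightarrow> degree f \<le> degree g)" by blast
  from someI_ex[OF this]
  have f: "f \<noteq> 0" "has_bch_roots F \<alpha> v f"
    and least: "\<And>g. g \<noteq> 0 \<Longrightarrow> has_bch_roots F \<alpha> v g \<Longrightarrow> degree f \<le> degree g"
    unfolding f_def bch_gen_def by auto
  have mult: "has_bch_roots F \<alpha> v (f * q)" for q
    using f(2) by (simp add: has_bch_roots_def eval_in_mult)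
  show ?thesis unfolding f_def[symmetric]
  proof
    assume "f dvd c"
    then show "has_bch_roots F \<alpha> v c" using mult by (auto elim: dvdE)
  next
    assume c: "has_bch_roots F \<alpha> v c"
    have "eval_in F (c mod f) (\<alpha> [^] i) = \<zero>" if "i \<in> {1..v}" for i
    proof -
      have "eval_in F (f * (c div f) + c mod f) (\<alpha> [^] i) = \<zero>"
        using c that by (simp add: has_bch_roots_def)
      moreover have "eval_in F (f * (c div f)) (\<alpha> [^] i) = \<zero>"
        using mult that by (simp add: has_bch_roots_def)
      ultimately show ?thesis by (simp only: eval_in_add nat_pow_closed alpha_closed l_zero eval_in_closed)
    qed
    then have "has_bch_roots F \<alpha> v (c mod f)" by (simp add: has_bch_roots_def)
    then have "c mod f = 0" using least[of "c mod f"] degree_mod_less[OF f(1), of c] by force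
    then show "f dvd c" by auto
  qed
qed

section \<open>Power-sum description of extended BCH codes\<close>

definition moment_sets :: "nat \<Rightarrow> nat set set" where
  "moment_sets k = {c. c \<subseteq> {..<N} \<and> (\<forall>j<k. (\<Oplus>i\<in>c. pos i [^] j) = \<zero>)}"

lemma finsum_bit_in: "finite A \<Longrightarrow> (\<Oplus>i\<in>A. bit_in F (f i)) = bit_in F (\<Sum>i\<in>A. f i)"
  by (induction A rule: finite_induct) (auto simp: bit_in_add Pi_def)

lemma finsum_bit_in_support:
  fixes c :: "nat set"
  assumes "c \<subseteq> {..<n}" "g \<in> {..<n} \<rightarrow> carrier F"
  shows "(\<Oplus>i\<in>{..<n}. bit_in F (of_bool (i \<in> c)) \<otimes> g i) = (\<Oplus>i\<in>c. g i)"
  using assms by (intro add.finprod_mono_neutral_cong_right) (auto simp: Pi_def)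

lemma finsum_last_position:
  assumes "f \<in> {..<N} \<rightarrow> carrier F"
  shows "(\<Oplus>i\<in>{..<N}. f i) = f (N - 1) \<oplus> (\<Oplus>i\<in>{..<N - 1}. f i)"
proof -
  have "{..<N} = insert (N - 1) {..<N - 1}" using N_ge_2 by auto
  moreover have "(\<Oplus>i\<in>insert (N - 1) {..<N - 1}. f i) = f (N - 1) \<oplus> (\<Oplus>i\<in>{..<N - 1}. f i)"
    using assms N_ge_2 by (intro finsum_insert) (auto simp: Pi_def)
  ultimately show ?thesis by simp
qed

text \<open>With \<open>0\<close> as the last evaluation point the parity bit contributes to the zeroth moment only.\<close>
lemma moments_extended_word:
  assumes "degree c < N - 1"
    and w: "\<And>i. i < N - 1 \<Longrightarrow> w i = coeff c i"
  shows "(\<forall>j<Suc v. (\<Oplus>i\<in>{..<N}. bit_in F (w i) \<otimes> pos i [^] j) = \<zero>) \<longleftrightarrow>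
    has_bch_roots F \<alpha> v c \<and> w (N - 1) = (\<Sum>j<N - 1. coeff c j)"
proof -
  have 0: "(\<Oplus>i\<in>{..<N}. bit_in F (w i) \<otimes> pos i [^] (0::nat)) = bit_in F (w (N - 1) + (\<Sum>j<N - 1. coeff c j))"
    by (subst finsum_last_position) (auto simp: finsum_bit_in bit_in_add w)
  have 1: "(\<Oplus>i\<in>{..<N}. bit_in F (w i) \<otimes> pos i [^] j) = eval_in F c (\<alpha> [^] j)" if "j > 0" for j :: nat
  proof -
    have "(\<Oplus>i\<in>{..<N}. bit_in F (w i) \<otimes> pos i [^] j) = (\<Oplus>i\<in>{..<N - 1}. bit_in F (w i) \<otimes> pos i [^] j)"
      using that by (subst finsum_last_position) (auto simp: pos_last nat_pow_zero)
    also have "\<dots> = (\<Oplus>i\<in>{..<N - 1}. bit_in F (coeff c i) \<otimes> (\<alpha> [^] j) [^] i)"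
      by (intro finsum_cong') (auto simp: w pos_def nat_pow_pow mult.commute)
    also have "\<dots> = eval_in F c (\<alpha> [^] j)" by (rule eval_in_eq_finsum[symmetric]) (use assms in auto)
    finally show ?thesis .
  qed
  have "bit_in F b = \<zero> \<longleftrightarrow> b = 0" for b by (auto simp: bit_in_def)
  moreover have "a + b = 0 \<longleftrightarrow> a = b" for a b :: bit
    by (cases a; cases b) (auto simp: add_bit_eq_xor)
  ultimately have "bit_in F (w (N - 1) + (\<Sum>j<N - 1. coeff c j)) = \<zero> \<longleftrightarrow> w (N - 1) = (\<Sum>j<N - 1. coeff c j)"
    by blast
  moreover have "(\<forall>j<Suc v. Q j) \<longleftrightarrow> (\<forall>j\<in>{1..v}. Q j) \<and> Q 0" for Q
  proof -
    have "{..<Suc v} = insert 0 {1..v}" by auto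
    then have "(\<forall>j\<in>{..<Suc v}. Q j) \<longleftrightarrow> (\<forall>j\<in>insert 0 {1..v}. Q j)" by simp
    then show ?thesis by auto
  qed
  ultimately show ?thesis using 0 1 by (simp add: has_bch_roots_def)
qed

text \<open>The shift to \<open>Suc v\<close> adds order 0, the overall parity check, in which the
  label zero also counts because its 0th power is one.\<close>

lemma eBCH_eq_moment_sets: "eBCH F \<alpha> m v = (\<lambda>c i. of_bool (i \<in> c)) ` moment_sets (Suc v)"
proof -
  \<comment> \<open>An intermediate description by words: compared with \<open>eBCH\<close> through
    the polynomial of the first \<open>N - 1\<close> bits, and with \<open>moment_sets\<close>
    through supports.\<close>
  define E where "E = {w. (\<forall>i\<ge>N. w i = 0) \<and> (\<forall>j<Suc v. (\<Oplus>i\<in>{..<N}. bit_in F (w i) \<otimes> pos i [^] j) = \<zero>)}"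
  have moments: "(\<Oplus>i\<in>{..<N}. bit_in F (of_bool (i \<in> c)) \<otimes> pos i [^] j) = (\<Oplus>i\<in>c. pos i [^] j)"
    if "c \<subseteq> {..<N}" for c and j :: nat
    using that by (intro finsum_bit_in_support) auto
  have "eBCH F \<alpha> m v = E"
  proof (intro equalityI subsetI)
    fix w assume "w \<in> eBCH F \<alpha> m v"
    then obtain c where c: "degree c < N - 1" "has_bch_roots F \<alpha> v c"
      and w: "w = (\<lambda>i. if i < N - 1 then coeff c i else if i = N - 1 then (\<Sum>j<N - 1. coeff c j) else 0)"
      by (auto simp: eBCH_def BCH_def bch_gen_dvd_iff)
    have "\<forall>i\<ge>N. w i = 0" using N_ge_2 by (auto simp: w)
    moreover have "\<forall>j<Suc v. (\<Oplus>i\<in>{..<N}. bit_in F (w i) \<otimes> pos i [^] j) = \<zero>"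
      using moments_extended_word[OF c(1), of w v] c(2) by (simp add: w)
    ultimately show "w \<in> E" by (simp add: E_def)
  next
    fix w assume w: "w \<in> E"
    define c where "c = Poly (map w [0..<N - 1])"
    have coeff: "coeff c i = (if i < N - 1 then w i else 0)" for i
      by (simp add: c_def nth_default_def)
    have deg: "degree c < N - 1" using N_ge_2 coeff by (intro degree_lessI) auto
    have "has_bch_roots F \<alpha> v c \<and> w (N - 1) = (\<Sum>j<N - 1. coeff c j)"
      using moments_extended_word[OF deg, of w v] w coeff by (simp add: E_def)
    then have "c \<in> BCH F \<alpha> m v"
      and "w = (\<lambda>i. if i < N - 1 then coeff c i else if i = N - 1 then (\<Sum>j<N - 1. coeff c j) else 0)"
      using deg coeff w by (auto simp: BCH_def bch_gen_dvd_iff E_def fun_eq_iff)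
    then show "w \<in> eBCH F \<alpha> m v" unfolding eBCH_def by (rule_tac image_eqI)
  qed
  also have "E = (\<lambda>c i. of_bool (i \<in> c)) ` moment_sets (Suc v)"
  proof (intro equalityI subsetI)
    fix w assume w: "w \<in> E"
    define c where "c = {i. w i = 1}"
    have w_eq: "w = (\<lambda>i. of_bool (i \<in> c))" by (auto simp: c_def fun_eq_iff)
    have c: "c \<subseteq> {..<N}" using w by (auto simp: c_def E_def not_le[symmetric])
    have "c \<in> moment_sets (Suc v)"
      using w c moments[OF c] by (simp add: moment_sets_def E_def w_eq)
    then show "w \<in> (\<lambda>c i. of_bool (i \<in> c)) ` moment_sets (Suc v)" using w_eq by blast
  next
    fix w :: "nat \<Rightarrow> bit" assume "w \<in> (\<lambda>c i. of_bool (i \<in> c)) ` moment_sets (Suc v)"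
    then obtain c where c: "c \<in> moment_sets (Suc v)" "w = (\<lambda>i. of_bool (i \<in> c))" by auto
    then show "w \<in> E"
      using moments[of c] by (auto simp: moment_sets_def E_def)
  qed
  finally show ?thesis .
qed

text \<open>The intersection is counted twice on the right and cancels in characteristic
  two.\<close>

lemma finsum_sym_diff:
  assumes "finite A" "finite B" "g \<in> A \<union> B \<rightarrow> carrier F"
  shows "(\<Oplus>i\<in>(A - B) \<union> (B - A). g i) = (\<Oplus>i\<in>A. g i) \<oplus> (\<Oplus>i\<in>B. g i)"
proof -
  define a where "a = (\<Oplus>i\<in>A - B. g i)"
  define b where "b = (\<Oplus>i\<in>B - A. g i)"
  define c where "c = (\<Oplus>i\<in>A \<inter> B. g i)"
  have abc: "a \<in> carrier F" "b \<in> carrier F" "c \<in> carrier F"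
    unfolding a_def b_def c_def using assms(3) by (auto intro!: finsum_closed)
  have "(\<Oplus>i\<in>(A - B) \<union> (B - A). g i) = a \<oplus> b"
    unfolding a_def b_def using assms by (intro finsum_Un_disjoint) auto
  moreover have "(\<Oplus>i\<in>(A - B) \<union> (A \<inter> B). g i) = a \<oplus> c"
    unfolding a_def c_def using assms by (intro finsum_Un_disjoint) auto
  moreover have "(\<Oplus>i\<in>(B - A) \<union> (A \<inter> B). g i) = b \<oplus> c"
    unfolding b_def c_def using assms by (intro finsum_Un_disjoint) auto
  moreover have "(A - B) \<union> (A \<inter> B) = A" "(B - A) \<union> (A \<inter> B) = B" by auto
  moreover have "(a \<oplus> c) \<oplus> (b \<oplus> c) = (a \<oplus> b) \<oplus> (c \<oplus> c)"
    using abc by (simp add: a_ac)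
  ultimately show ?thesis using abc by (simp add: char_two)
qed

lemma moment_sets_subset: "c \<in> moment_sets k \<Longrightarrow> c \<subseteq> {..<N}"
  by (simp add: moment_sets_def)

lemma finite_moment_set: "c \<in> moment_sets k \<Longrightarrow> finite c"
  using moment_sets_subset finite_subset by blast

lemma finite_moment_sets: "finite (moment_sets k)"
  using moment_sets_subset by (intro finite_subset[of "moment_sets k" "Pow {..<N}"]) auto

lemma sym_diff_moment_sets:
  assumes "c \<in> moment_sets k" "d \<in> moment_sets k"
  shows "(c - d) \<union> (d - c) \<in> moment_sets k"
  using assms finite_moment_set[OF assms(1)] finite_moment_set[OF assms(2)]
  by (auto simp: moment_sets_def finsum_sym_diff Pi_def simp del: Un_iff)

lemma empty_moment_sets: "{} \<in> moment_sets k"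
  by (simp add: moment_sets_def)

section \<open>Products of linear factors: minimum distance and affine symmetry\<close>

primrec lin_prod :: "('a \<times> 'a) list \<Rightarrow> 'a \<Rightarrow> 'a" where
  "lin_prod [] x = \<one>"
| "lin_prod (ab # ps) x = (fst ab \<otimes> x \<oplus> snd ab) \<otimes> lin_prod ps x"

lemma lin_prod_closed [simp]:
  "set ps \<subseteq> carrier F \<times> carrier F \<Longrightarrow> x \<in> carrier F \<Longrightarrow> lin_prod ps x \<in> carrier F"
  by (induction ps) auto

lemma lin_prod_replicate:
  assumes "a \<in> carrier F" "b \<in> carrier F" "x \<in> carrier F"
  shows "lin_prod (replicate j (a, b)) x = (a \<otimes> x \<oplus> b) [^] j"
  using assms by (induction j) (auto simp: m_comm)

text \<open>A list of linear factors stands for a polynomial over the field. Expanding one factor at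
  a time reduces the sum to moments of order below \<open>n\<close>; the extra power
  \<open>k\<close> makes the induction go through.\<close>

lemma moment_lin_prod:
  assumes c: "c \<in> moment_sets n"
  shows "set ps \<subseteq> carrier F \<times> carrier F \<Longrightarrow> k + length ps < n \<Longrightarrow>
    (\<Oplus>i\<in>c. pos i [^] k \<otimes> lin_prod ps (pos i)) = \<zero>"
proof (induction ps arbitrary: k)
  case Nil
  then show ?case using c by (simp add: moment_sets_def)
next
  case (Cons ab ps)
  obtain a b where ab: "ab = (a, b)" "a \<in> carrier F" "b \<in> carrier F" using Cons.prems by (cases ab) auto
  have ps: "set ps \<subseteq> carrier F \<times> carrier F" using Cons.prems by simp
  note [simp] = lin_prod_closed[OF ps] ab(2,3)
  let ?f = "\<lambda>k i. pos i [^] (k::nat) \<otimes> lin_prod ps (pos i)"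
  have "(\<Oplus>i\<in>c. pos i [^] k \<otimes> lin_prod (ab # ps) (pos i)) =
      (\<Oplus>i\<in>c. a \<otimes> ?f (Suc k) i \<oplus> b \<otimes> ?f k i)"
    by (intro finsum_cong') (auto simp: ab(1) l_distr r_distr m_ac)
  also have "\<dots> = (\<Oplus>i\<in>c. a \<otimes> ?f (Suc k) i) \<oplus> (\<Oplus>i\<in>c. b \<otimes> ?f k i)"
    by (intro finsum_addf) auto
  also have "\<dots> = a \<otimes> (\<Oplus>i\<in>c. ?f (Suc k) i) \<oplus> b \<otimes> (\<Oplus>i\<in>c. ?f k i)"
    using finite_moment_set[OF c] by (simp add: finsum_rdistr Pi_def)
  also have "\<dots> = \<zero>" using Cons.IH[OF ps, of "Suc k"] Cons.IH[OF ps, of k] Cons.prems by simp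
  finally show ?case .
qed

lemma lin_prod_eq_0_iff:
  assumes "x \<in> carrier F" "set ys \<subseteq> carrier F"
  shows "lin_prod (map (\<lambda>y. (\<one>, \<ominus> y)) ys) x = \<zero> \<longleftrightarrow> x \<in> set ys"
  using assms(2)
proof (induction ys)
  case (Cons y ys)
  have "x \<oplus> \<ominus> y = \<zero> \<longleftrightarrow> x = y"
    using Cons.prems assms(1) by (metis add.inv_closed list.set_intros(1) minus_equality minus_minus r_neg subsetD)
  moreover have "lin_prod (map (\<lambda>y. (\<one>, \<ominus> y)) ys) x \<in> carrier F"
    using Cons.prems assms(1) by (intro lin_prod_closed) auto
  ultimately show ?case using Cons assms(1) by (simp add: integral_iff)
qed simp

text \<open>The BCH bound: the product of \<open>x - pos i\<close> over all but one element of a small support is a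
  polynomial of low degree that is orthogonal to the word, yet vanishes at all but one support point.\<close>
lemma card_moment_set_gt:
  assumes c: "c \<in> moment_sets n" "c \<noteq> {}"
  shows "n < card c"
proof (rule ccontr)
  assume "\<not> n < card c"
  obtain i where i: "i \<in> c" using c by auto
  have fin: "finite c" using finite_moment_set c by simp
  then obtain js where js: "set js = c - {i}" "distinct js"
    using finite_distinct_list[of "c - {i}"] by auto
  define ps where "ps = map (\<lambda>y. (\<one>, \<ominus> y)) (map pos js)"
  have ps: "set ps \<subseteq> carrier F \<times> carrier F" by (auto simp: ps_def)
  have "length js = card c - 1" using js fin i by (metis card_Diff_singleton distinct_card)
  moreover have "card c > 0" using fin i by (auto simp: card_gt_0_iff)
  \<comment> \<open>Position \<open>i\<close> has no factor, so the degree is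
    \<open>card c - 1\<close>, which is below \<open>n\<close> even for \<open>card c = n\<close>;
    hence the strict bound.\<close>
  ultimately have len: "length ps < n" using \<open>\<not> n < card c\<close> by (simp add: ps_def)
  have inj: "inj_on pos c"
    using pos_bij moment_sets_subset[OF c(1)] by (meson bij_betw_imp_inj_on inj_on_subset)
  have zero: "lin_prod ps (pos j) = \<zero> \<longleftrightarrow> j \<noteq> i" if "j \<in> c" for j
  proof -
    have "lin_prod ps (pos j) = \<zero> \<longleftrightarrow> pos j \<in> pos ` (c - {i})"
      unfolding ps_def by (subst lin_prod_eq_0_iff) (auto simp: js(1))
    also have "\<dots> \<longleftrightarrow> j \<in> c - {i}" using inj_on_image_mem_iff[OF inj that, of "c - {i}"] by auto
    finally show ?thesis using that by simp
  qed
  have "\<zero> = (\<Oplus>j\<in>c. pos j [^] (0::nat) \<otimes> lin_prod ps (pos j))"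
    using moment_lin_prod[OF c(1) ps, of 0] len by simp
  also have "\<dots> = (\<Oplus>j\<in>{i}. lin_prod ps (pos j))"
    using fin i ps zero by (intro add.finprod_mono_neutral_cong_right) auto
  also have "\<dots> = lin_prod ps (pos i)" using ps by (simp add: finsum_singleton)
  finally show False using zero[OF i] by simp
qed

lemma affine_bij:
  assumes "a \<in> carrier F" "b \<in> carrier F" "a \<noteq> \<zero>"
  shows "bij_betw (\<lambda>x. a \<otimes> x \<oplus> b) (carrier F) (carrier F)"
proof -
  have inj: "inj_on (\<lambda>x. a \<otimes> x \<oplus> b) (carrier F)"
    using assms by (auto simp: inj_on_def m_lcancel)
  moreover have "(\<lambda>x. a \<otimes> x \<oplus> b) ` carrier F = carrier F"
    using assms by (intro endo_inj_surj finite_F inj) auto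
  ultimately show ?thesis by (simp add: bij_betw_def)
qed

lemma affine_interpolation:
  assumes xy: "x \<in> carrier F" "y \<in> carrier F" "x \<noteq> y"
    and xy': "x' \<in> carrier F" "y' \<in> carrier F" "x' \<noteq> y'"
  obtains a b where "a \<in> carrier F" "b \<in> carrier F" "a \<noteq> \<zero>" "a \<otimes> x \<oplus> b = x'" "a \<otimes> y \<oplus> b = y'"
proof -
  have "x \<ominus> y \<noteq> \<zero>" "x' \<ominus> y' \<noteq> \<zero>"
    using assms minus_equality minus_minus by (metis a_minus_def a_inv_closed add.inv_equality)+
  then have u: "x \<ominus> y \<in> Units F" using xy by (simp add: field_Units)
  define a where "a = (x' \<ominus> y') \<otimes> inv (x \<ominus> y)"
  define b where "b = x' \<ominus> a \<otimes> x"
  have a: "a \<in> carrier F" using u xy' by (simp add: a_def)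
  have b: "b \<in> carrier F" using a xy xy' by (simp add: b_def)
  have ad: "a \<otimes> (x \<ominus> y) = x' \<ominus> y'" using u xy' xy by (simp add: a_def m_assoc)
  then have "a \<noteq> \<zero>" using \<open>x' \<ominus> y' \<noteq> \<zero>\<close> xy by auto
  moreover have 1: "a \<otimes> x \<oplus> b = x'" using a xy xy' unfolding b_def by algebra
  moreover have "a \<otimes> y \<oplus> b = y'"
  proof -
    have "a \<otimes> y \<oplus> b = (a \<otimes> x \<oplus> b) \<ominus> a \<otimes> (x \<ominus> y)" using a b xy by algebra
    also have "\<dots> = y'" unfolding 1 ad using xy' by algebra
    finally show ?thesis .
  qed
  ultimately show ?thesis using that a b by blast
qed

text \<open>The \<open>j\<close>-th power sum of the image is the sum of (a x + b)^j over the
  original set, a polynomial of degree at most \<open>j\<close>.\<close>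

lemma moment_sets_affine_invariant:
  assumes "a \<in> carrier F" "b \<in> carrier F"
    and \<sigma>: "bij_betw \<sigma> {..<N} {..<N}" "\<And>i. i < N \<Longrightarrow> pos (\<sigma> i) = a \<otimes> pos i \<oplus> b"
    and c: "c \<in> moment_sets k"
  shows "\<sigma> ` c \<in> moment_sets k"
proof -
  note sub = moment_sets_subset[OF c]
  have inj: "inj_on \<sigma> c" using \<sigma>(1) sub by (meson bij_betw_imp_inj_on inj_on_subset)
  have "(\<Oplus>i\<in>\<sigma> ` c. pos i [^] j) = \<zero>" if "j < k" for j
  proof -
    have "(\<Oplus>i\<in>\<sigma> ` c. pos i [^] j) = (\<Oplus>i\<in>c. pos (\<sigma> i) [^] j)"
      by (intro finsum_reindex inj) auto
    also have "\<dots> = (\<Oplus>i\<in>c. pos i [^] (0::nat) \<otimes> lin_prod (replicate j (a, b)) (pos i))"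
      using sub assms by (intro finsum_cong') (auto simp: lin_prod_replicate subset_iff)
    also have "\<dots> = \<zero>" using that assms by (intro moment_lin_prod[OF c]) auto
    finally show ?thesis .
  qed
  moreover have "\<sigma> ` c \<subseteq> {..<N}" using \<sigma>(1) sub by (auto simp: bij_betw_def)
  ultimately show ?thesis by (simp add: moment_sets_def)
qed

lemma moment_sets_doubly_transitive: "doubly_transitive_code (moment_sets k) N"
proof
  fix i j i' j'
  assume ij: "i < N" "j < N" "i \<noteq> j" "i' < N" "j' < N" "i' \<noteq> j'"
  have inj: "inj_on pos {..<N}" using pos_bij by (simp add: bij_betw_def)
  then have "pos i \<noteq> pos j" "pos i' \<noteq> pos j'" using ij by (auto simp: inj_on_def)
  then obtain a b where ab: "a \<in> carrier F" "b \<in> carrier F" "a \<noteq> \<zero>"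
    "a \<otimes> pos i \<oplus> b = pos i'" "a \<otimes> pos j \<oplus> b = pos j'"
    using affine_interpolation[of "pos i" "pos j" "pos i'" "pos j'"] by auto
  \<comment> \<open>The interpolating affine map, carried from field elements to positions along
    \<open>pos\<close>.\<close>
  define \<sigma> where "\<sigma> = inv_into {..<N} pos \<circ> ((\<lambda>x. a \<otimes> x \<oplus> b) \<circ> pos)"
  have \<sigma>: "bij_betw \<sigma> {..<N} {..<N}"
    unfolding \<sigma>_def by (intro bij_betw_trans[of _ _ "carrier F"] pos_bij affine_bij bij_betw_inv_into) fact+
  have pos_\<sigma>: "pos (\<sigma> l) = a \<otimes> pos l \<oplus> b" for l
    using bij_betw_inv_into_right[OF pos_bij] ab by (simp add: \<sigma>_def)
  have "\<sigma> i = i'" "\<sigma> j = j'"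
    unfolding \<sigma>_def using ab(4,5) ij inv_into_f_f[OF inj] by simp_all
  then show "\<exists>\<sigma>. bij_betw \<sigma> {..<N} {..<N} \<and> \<sigma> i = i' \<and> \<sigma> j = j' \<and> (\<forall>c\<in>moment_sets k. \<sigma> ` c \<in> moment_sets k)"
    using \<sigma> pos_\<sigma> moment_sets_affine_invariant[OF ab(1,2) \<sigma>] by blast
qed (use N_ge_2 moment_sets_subset empty_moment_sets sym_diff_moment_sets in auto)

section \<open>Dimension count and choice of the parameter\<close>

lemma card_moment_sets_Suc: "card (moment_sets k) \<le> N * card (moment_sets (Suc k))"
proof -
  \<comment> \<open>An additive map into a field of \<open>N\<close> elements with kernel
    \<open>moment_sets (Suc k)\<close>. A nonempty fibre is carried into the kernel by adding one of
    its elements.\<close>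
  define \<phi> where "\<phi> c = (\<Oplus>i\<in>c. pos i [^] k)" for c
  have fibre: "card {c\<in>moment_sets k. \<phi> c = y} \<le> card (moment_sets (Suc k))" for y
  proof (cases "\<exists>c0. c0 \<in> moment_sets k \<and> \<phi> c0 = y")
    case False
    then have empty: "{c\<in>moment_sets k. \<phi> c = y} = {}" by auto
    show ?thesis unfolding empty by simp
  next
    case True
    then obtain c0 where c0: "c0 \<in> moment_sets k" "\<phi> c0 = y" by auto
    show ?thesis
    proof (rule card_inj_on_le[where f = "\<lambda>c. (c - c0) \<union> (c0 - c)"])
      show "inj_on (\<lambda>c. (c - c0) \<union> (c0 - c)) {c\<in>moment_sets k. \<phi> c = y}"
        by (rule inj_on_inverseI[where g = "\<lambda>c. (c - c0) \<union> (c0 - c)"]) auto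
      show "(\<lambda>c. (c - c0) \<union> (c0 - c)) ` {c\<in>moment_sets k. \<phi> c = y} \<subseteq> moment_sets (Suc k)"
      proof (clarify)
        fix c assume c: "c \<in> moment_sets k" "y = \<phi> c"
        have "\<phi> ((c - c0) \<union> (c0 - c)) = \<phi> c \<oplus> \<phi> c0"
          unfolding \<phi>_def using finite_moment_set[OF c(1)] finite_moment_set[OF c0(1)]
          by (intro finsum_sym_diff) auto
        also have "\<dots> = \<zero>" unfolding c0(2) c(2)[symmetric] unfolding c(2)
          by (intro char_two) (auto simp: \<phi>_def intro!: finsum_closed)
        finally show "(c - c0) \<union> (c0 - c) \<in> moment_sets (Suc k)"
          using sym_diff_moment_sets[OF c(1) c0(1)] by (auto simp: moment_sets_def \<phi>_def less_Suc_eq)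
      qed
    qed (rule finite_moment_sets)
  qed
  have "moment_sets k = (\<Union>y\<in>carrier F. {c\<in>moment_sets k. \<phi> c = y})"
    by (auto simp: \<phi>_def intro!: finsum_closed)
  then have "card (moment_sets k) \<le> (\<Sum>y\<in>carrier F. card {c\<in>moment_sets k. \<phi> c = y})"
    using card_UN_le[OF finite_F, of "\<lambda>y. {c\<in>moment_sets k. \<phi> c = y}"] by simp
  also have "\<dots> \<le> (\<Sum>y\<in>carrier F. card (moment_sets (Suc k)))"
    by (intro sum_mono fibre)
  finally show ?thesis by (simp add: card_F)
qed

definition dimension :: "nat \<Rightarrow> real" where
  "dimension k = log 2 (real (card (moment_sets k)))"

lemma card_moment_sets_pos: "card (moment_sets k) > 0"
  using finite_moment_sets empty_moment_sets by (auto simp: card_gt_0_iff)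

lemma dimension_Suc: "dimension k \<le> dimension (Suc k) + real m"
proof -
  have "real (card (moment_sets k)) \<le> real (N * card (moment_sets (Suc k)))"
    using card_moment_sets_Suc by (intro of_nat_mono)
  then have "dimension k \<le> log 2 (2 ^ m * real (card (moment_sets (Suc k))))"
    unfolding dimension_def using card_moment_sets_pos[of k] by (intro log_mono) auto
  also have "\<dots> = real m + dimension (Suc k)"
    unfolding dimension_def using card_moment_sets_pos[of "Suc k"] by (subst log_mult) auto
  finally show ?thesis by simp
qed

lemma dimension_0: "dimension 0 = real N"
proof -
  have "moment_sets 0 = Pow {..<N}" by (auto simp: moment_sets_def)
  then show ?thesis by (simp add: dimension_def card_Pow)
qed

lemma dimension_ge: "dimension k \<ge> real N - real m * real k"
proof (induction k)
  case (Suc k)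
  then show ?case using dimension_Suc[of k] by (simp add: algebra_simps)
qed (simp add: dimension_0)

text \<open>By the BCH bound a nonempty member would have more than \<open>N\<close>
  positions.\<close>

lemma dimension_N: "dimension N = 0"
proof -
  have "c = {}" if "c \<in> moment_sets N" for c
    using card_moment_set_gt[OF that] card_mono[OF _ moment_sets_subset[OF that]] by force
  then have "moment_sets N = {{}}" using empty_moment_sets by auto
  then show ?thesis by (simp add: dimension_def)
qed

text \<open>The least admissible \<open>v\<close> is taken. If \<open>v > 1\<close>, then
  \<open>v - 1\<close> exceeds the target rate and one more moment costs at most \<open>m\<close>
  dimensions; if \<open>v = 1\<close>, only two moments are imposed. The minimum covers both
  cases.\<close>

lemma exists_eBCH_parameter:
  assumes "0 \<le> r"
  obtains v where "1 \<le> v" "v \<le> N - 1" "dimension (Suc v) \<le> r * real N"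
    "dimension (Suc v) \<ge> min (r * real N - real m) (real N - 2 * real m)"
proof -
  define P where "P v \<longleftrightarrow> 1 \<le> v \<and> dimension (Suc v) \<le> r * real N" for v
  have "Suc (N - 1) = N" using N_ge_2 by simp
  then have PN: "P (N - 1)" using N_ge_2 assms dimension_N by (simp add: P_def)
  define v where "v = (LEAST v. P v)"
  have v: "P v" "v \<le> N - 1" unfolding v_def using PN by (auto intro: LeastI Least_le)
  have "dimension (Suc v) \<ge> min (r * real N - real m) (real N - 2 * real m)"
  proof (cases "v = 1")
    case True
    then show ?thesis using dimension_ge[of 2] by (simp add: numeral_2_eq_2)
  next
    case False
    then have v1: "v - 1 < v" "Suc (v - 1) = v" "1 \<le> v - 1" using v by (auto simp: P_def)
    then have "\<not> P (v - 1)" unfolding v_def using not_less_Least by blast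
    then have "dimension v > r * real N" using v1 by (simp add: P_def)
    then show ?thesis using dimension_Suc[of v] by simp
  qed
  then show ?thesis using that v by (auto simp: P_def)
qed

lemma code_rate_eBCH: "code_rate (eBCH F \<alpha> m v) N = dimension (Suc v) / real N"
proof -
  have "inj_on (\<lambda>c i. of_bool (i \<in> c) :: bit) (moment_sets (Suc v))"
    by (auto simp: inj_on_def fun_eq_iff)
  then show ?thesis
    by (simp add: code_rate_def dimension_def eBCH_eq_moment_sets card_image)
qed

text \<open>As \<open>Suc v\<close> moments cost at most \<open>m\<close> dimensions each, rate at
  most \<open>r\<close> forces (1 - r) N \<le> m (v + 1). The minimum distance is at least
  \<open>Suc v\<close>, so the factor \<open>N\<close> of the failure bound cancels up to m / (1 -
  r).\<close>

lemma block_error_prob_eBCH_le: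
  assumes p: "0 \<le> p" "p < 1 - r" and r: "0 \<le> r" "r < 1"
    and dim: "dimension (Suc v) \<le> r * real N"
  defines "q \<equiv> (p + (1 - r)) / 2"
  shows "block_error_prob (eBCH F \<alpha> m v) N p
    \<le> real m / (1 - r) * (real N - 1) powr (- ((1 - r / (1 - q)) * (q - p) / 4))"
    and "0 \<le> block_error_prob (eBCH F \<alpha> m v) N p"
proof -
  interpret doubly_transitive_code "moment_sets (Suc v)" N
    by (rule moment_sets_doubly_transitive)
  define P where "P = block_error_prob (eBCH F \<alpha> m v) N p"
  define X where "X = (real N - 1) powr (- ((1 - r / (1 - q)) * (q - p) / 4))"
  have P: "P = cube_exp p N (\<lambda>E. of_bool (\<exists>c\<in>moment_sets (Suc v). c \<noteq> {} \<and> c \<subseteq> E))"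
    unfolding P_def eBCH_eq_moment_sets by (rule block_error_prob_eq)
  have "P \<ge> 0" unfolding P using p r by (intro cube_exp_nonneg) auto
  then show "0 \<le> block_error_prob (eBCH F \<alpha> m v) N p" by (simp add: P_def)
  have bound: "real (Suc v) * P \<le> real N * X"
    unfolding P X_def q_def
  proof (rule block_failure_bound)
    show "log 2 (real (card (moment_sets (Suc v)))) \<le> r * real N"
      using dim by (simp add: dimension_def)
    show "Suc v \<le> card c" if "c \<in> moment_sets (Suc v)" "c \<noteq> {}" for c
      using card_moment_set_gt[OF that] by simp
  qed (use p r in auto)
  have "(1 - r) * real N \<le> real m * real (Suc v)"
    using dimension_ge[of "Suc v"] dim by (simp add: algebra_simps)
  then have "(1 - r) * real N * P \<le> real m * real (Suc v) * P"
    using \<open>P \<ge> 0\<close> by (rule mult_right_mono)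
  also have "\<dots> \<le> real m * (real N * X)"
    using bound by (simp add: mult.assoc mult_left_mono del: of_nat_Suc)
  finally have "real N * ((1 - r) * P) \<le> real N * (real m * X)" by (simp add: mult_ac)
  then have "(1 - r) * P \<le> real m * X" by simp
  then show "block_error_prob (eBCH F \<alpha> m v) N p
    \<le> real m / (1 - r) * (real N - 1) powr (- ((1 - r / (1 - q)) * (q - p) / 4))"
    unfolding P_def[symmetric] X_def[symmetric] using r by (simp add: field_simps)
qed

end

section \<open>Convergence of the rates and of the block error probability\<close>

theorem theorem9:
  fixes F :: "nat \<Rightarrow> ('a, 'b) ring_scheme" and \<alpha> :: "nat \<Rightarrow> 'a" and r :: real
  assumes fields: "\<And>m. m \<ge> 1 \<Longrightarrow> field (F m)"
    and card_F: "\<And>m. m \<ge> 1 \<Longrightarrow> card (carrier (F m)) = 2 ^ m"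
    and alpha_nz: "\<And>m. m \<ge> 1 \<Longrightarrow> \<alpha> m \<in> carrier (F m) - {\<zero>\<^bsub>F m\<^esub>}"
    and primitive: "\<And>m. m \<ge> 1 \<Longrightarrow>
        carrier (F m) - {\<zero>\<^bsub>F m\<^esub>} = range (\<lambda>k::nat. \<alpha> m [^]\<^bsub>F m\<^esub> k)"
    and r: "0 < r" "r < 1"
  shows "\<exists>v :: nat \<Rightarrow> nat.
           (\<forall>m\<ge>1. 1 \<le> v m \<and> v m \<le> 2 ^ m - 1) \<and>
           (\<lambda>m. code_rate (eBCH (F m) (\<alpha> m) m (v m)) (2 ^ m)) \<longlonglongrightarrow> r \<and>
           (\<forall>p. 0 \<le> p \<and> p < 1 - r \<longrightarrow>
              (\<lambda>m. block_error_prob (eBCH (F m) (\<alpha> m) m (v m)) (2 ^ m) p) \<longlonglongrightarrow> 0)"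
proof -
  have pf: "primitive_field (F m) (\<alpha> m) m" if "m \<ge> 1" for m
    by (intro primitive_field.intro primitive_field_axioms.intro fields card_F alpha_nz primitive that)
  define dim where "dim m v = primitive_field.dimension (F m) (\<alpha> m) m (Suc v)" for m v
  \<comment> \<open>Nothing is assumed about \<open>m = 0\<close>, so the value of \<open>v\<close>
    there is left free.\<close>
  have "\<forall>m. \<exists>v. m \<ge> 1 \<longrightarrow> 1 \<le> v \<and> v \<le> 2 ^ m - 1 \<and> dim m v \<le> r * real (2 ^ m) \<and>
      dim m v \<ge> min (r * real (2 ^ m) - real m) (real (2 ^ m) - 2 * real m)"
  proof (intro allI)
    fix m
    show "\<exists>v. m \<ge> 1 \<longrightarrow> 1 \<le> v \<and> v \<le> 2 ^ m - 1 \<and> dim m v \<le> r * real (2 ^ m) \<and>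
      dim m v \<ge> min (r * real (2 ^ m) - real m) (real (2 ^ m) - 2 * real m)"
    proof (cases "m \<ge> 1")
      case True
      then show ?thesis
        using primitive_field.exists_eBCH_parameter[OF pf[OF True], of r] r unfolding dim_def
        by (metis less_imp_le)
    qed simp
  qed
  then obtain v where v: "1 \<le> v m" "v m \<le> 2 ^ m - 1" "dim m (v m) \<le> r * real (2 ^ m)"
      "dim m (v m) \<ge> min (r * real (2 ^ m) - real m) (real (2 ^ m) - 2 * real m)" if "m \<ge> 1" for m
    by metis
  have rate: "code_rate (eBCH (F m) (\<alpha> m) m (v m)) (2 ^ m) = dim m (v m) / 2 ^ m" if "m \<ge> 1" for m
    using primitive_field.code_rate_eBCH[OF pf[OF that]] by (simp add: dim_def)
  have "(\<lambda>m. code_rate (eBCH (F m) (\<alpha> m) m (v m)) (2 ^ m)) \<longlonglongrightarrow> r"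
  proof (rule tendsto_sandwich)
    show "\<forall>\<^sub>F m in sequentially. min (r - real m / 2 ^ m) (1 - 2 * (real m / 2 ^ m))
        \<le> code_rate (eBCH (F m) (\<alpha> m) m (v m)) (2 ^ m)"
      using eventually_ge_at_top[of "1::nat"]
    proof eventually_elim
      case (elim m)
      have "min (r - real m / 2 ^ m) (1 - 2 * (real m / 2 ^ m)) * 2 ^ m
          = min (r * real (2 ^ m) - real m) (real (2 ^ m) - 2 * real m)"
        by (subst min_mult_distrib_right) (simp add: left_diff_distrib)
      also have "\<dots> \<le> dim m (v m)" by (rule v(4)[OF elim])
      finally show ?case by (simp only: rate[OF elim] pos_le_divide_eq zero_less_power zero_less_numeral)
    qed
    show "\<forall>\<^sub>F m in sequentially. code_rate (eBCH (F m) (\<alpha> m) m (v m)) (2 ^ m) \<le> r"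
      using eventually_ge_at_top[of "1::nat"]
    proof eventually_elim
      case (elim m)
      show ?case using v(3)[OF elim] by (simp add: rate[OF elim] divide_le_eq)
    qed
    have "(\<lambda>m. real m / 2 ^ m) \<longlonglongrightarrow> 0" by real_asymp
    \<comment> \<open>The second entry tends to 1, which exceeds \<open>r\<close>, so the case
      \<open>v = 1\<close> does not lower the limit.\<close>
    then have "(\<lambda>m. min (r - real m / 2 ^ m) (1 - 2 * (real m / 2 ^ m))) \<longlonglongrightarrow> min (r - 0) (1 - 2 * 0)"
      by (intro tendsto_intros)
    then show "(\<lambda>m. min (r - real m / 2 ^ m) (1 - 2 * (real m / 2 ^ m))) \<longlonglongrightarrow> r"
      using r by simp
  qed simp
  moreover have "(\<lambda>m. block_error_prob (eBCH (F m) (\<alpha> m) m (v m)) (2 ^ m) p) \<longlonglongrightarrow> 0"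
    if p: "0 \<le> p" "p < 1 - r" for p
  proof -
    define q where "q = (p + (1 - r)) / 2"
    \<comment> \<open>Positive and independent of \<open>m\<close>, so the bound is \<open>m\<close>
      times a factor decaying exponentially in \<open>m\<close>.\<close>
    define \<kappa> where "\<kappa> = (1 - r / (1 - q)) * (q - p) / 4"
    have "p < q" "r < 1 - q" using p by (simp_all add: q_def field_simps)
    then have "\<kappa> > 0" using r by (simp add: \<kappa>_def)
    show ?thesis
    proof (rule tendsto_sandwich)
      show "\<forall>\<^sub>F m in sequentially. block_error_prob (eBCH (F m) (\<alpha> m) m (v m)) (2 ^ m) p
          \<le> real m / (1 - r) * (2 ^ m - 1) powr (- \<kappa>)"
        using eventually_ge_at_top[of "1::nat"]
      proof eventually_elim
        case (elim m)
        show ?case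
          using primitive_field.block_error_prob_eBCH_le(1)[OF pf[OF elim] p] v(3)[OF elim] r
          by (simp add: dim_def \<kappa>_def q_def)
      qed
      show "\<forall>\<^sub>F m in sequentially. 0 \<le> block_error_prob (eBCH (F m) (\<alpha> m) m (v m)) (2 ^ m) p"
        using eventually_ge_at_top[of "1::nat"]
      proof eventually_elim
        case (elim m)
        show ?case
          using primitive_field.block_error_prob_eBCH_le(2)[OF pf[OF elim] p] v(3)[OF elim] r
          by (simp add: dim_def)
      qed
      show "(\<lambda>m. real m / (1 - r) * (2 ^ m - 1) powr (- \<kappa>)) \<longlonglongrightarrow> 0"
        using \<open>\<kappa> > 0\<close> r by real_asymp
    qed simp
  qed
  ultimately show ?thesis using v(1,2) by blast
qed

end
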